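(* Let $\mathsf k$ be a field. Let $H$ be a Hopf algebra over $\mathsf k$ with bijective antipode, and assume the category $\mathcal C(H)$ has the property that every object is locally finite. If $D$ is a Hopf subalgebra of $H$ such that $\operatorname{ind}_D^H(\mathsf k)\cong\mathsf k$, then any two modules $V_1,V_2\in\mathcal C(H)$ are isomorphic if and only if $\operatorname{res}_D^H(V_1)\cong\operatorname{res}_D^H(V_2)$ as $D$-modules.
   Context: $\mathcal C(H)$ is a full tensor subcategory of the category of $H$-modules, closed under tensor products (given by a topology on $H$), and $\mathcal C(D)$ is a full subcategory of $D$-modules such that the restriction functor $\operatorname{res}_D^H:\mathcal C(H)\to\mathcal C(D)$ has a right adjoint $\operatorname{ind}_D^H:\mathcal C(D)\to\mathcal C(H)$. Standing conventions: $\operatorname{ind}_D^H$ commutes with direct limits, every object of $\mathcal C(H)$ is a direct limit of objects finitely generated over $\mathsf k$, and (with $H$ having bijective antipode) the tensor identity holds: for any $D$-module $N$ in $\mathcal C(D)$ and any $V$ in $\mathcal C(H)$, $\operatorname{ind}_D^H(N\otimes V)\cong\operatorname{ind}_D^H(N)\otimes V$ and $\operatorname{ind}_D^H(V\otimes N)\cong V\otimes\operatorname{ind}_D^H(N)$. Locally finite means every element lies in a finite-dimensional submodule. $\mathsf k$ denotes the trivial module (via the counit). *)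

theory Defs
  imports "HOL-Algebra.Module" "HOL-Algebra.AbelCoset" "HOL-Analysis.Abstract_Topology"
begin

section \<open>Vector spaces and tensor products\<close>

text \<open>
  A vector space over a field \<open>K\<close> is a \<open>Module.module K V\<close>. The record type \<open>module\<close> of
  HOL-Algebra extends \<open>ring\<close>, so it also carries \<open>mult\<close> and \<open>one\<close>; these are meaningful for
  algebras and irrelevant for vector spaces.
\<close>

definition linear_map ::
  "('k, 'm) ring_scheme \<Rightarrow> ('k, 'v, 'n) module_scheme \<Rightarrow> ('k, 'w, 'p) module_scheme
    \<Rightarrow> ('v \<Rightarrow> 'w) \<Rightarrow> bool" where
  "linear_map K V W f \<longleftrightarrow>
     f \<in> carrier V \<rightarrow> carrier W \<and>
     (\<forall>x\<in>carrier V. \<forall>y\<in>carrier V. f (x \<oplus>\<^bsub>V\<^esub> y) = f x \<oplus>\<^bsub>W\<^esub> f y) \<and>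
     (\<forall>c\<in>carrier K. \<forall>x\<in>carrier V. f (c \<odot>\<^bsub>V\<^esub> x) = c \<odot>\<^bsub>W\<^esub> f x)"

definition span_of ::
  "('k, 'm) ring_scheme \<Rightarrow> ('k, 'v, 'n) module_scheme \<Rightarrow> 'v set \<Rightarrow> 'v set" where
  "span_of K V B = \<Inter> {N. submodule N K V \<and> B \<subseteq> N}"

definition fin_dim :: "('k, 'm) ring_scheme \<Rightarrow> ('k, 'v, 'n) module_scheme \<Rightarrow> bool" where
  "fin_dim K V \<longleftrightarrow> (\<exists>B. finite B \<and> B \<subseteq> carrier V \<and> span_of K V B = carrier V)"

definition free_module :: "('k, 'm) ring_scheme \<Rightarrow> 'b set \<Rightarrow> ('k, 'b \<Rightarrow> 'k) module" where
  "free_module K B =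
     \<lparr>carrier = {f. f \<in> B \<rightarrow> carrier K \<and> (\<forall>b. b \<notin> B \<longrightarrow> f b = \<zero>\<^bsub>K\<^esub>) \<and> finite {b. f b \<noteq> \<zero>\<^bsub>K\<^esub>}},
      mult = undefined, one = undefined,
      zero = (\<lambda>b. \<zero>\<^bsub>K\<^esub>), add = (\<lambda>f g b. f b \<oplus>\<^bsub>K\<^esub> g b),
      smult = (\<lambda>c f b. c \<otimes>\<^bsub>K\<^esub> f b)\<rparr>"

definition free_gen :: "('k, 'm) ring_scheme \<Rightarrow> 'b \<Rightarrow> 'b \<Rightarrow> 'k" where
  "free_gen K b = (\<lambda>b'. if b' = b then \<one>\<^bsub>K\<^esub> else \<zero>\<^bsub>K\<^esub>)"

text \<open>
  \<open>V \<otimes> W\<close> is the free vector space on \<open>V \<times> W\<close> modulo the subspace spanned by the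
  bilinearity relations; its elements are the cosets of that subspace.
\<close>

abbreviation pair_space ::
  "('k, 'm) ring_scheme \<Rightarrow> ('k, 'v, 'n) module_scheme \<Rightarrow> ('k, 'w, 'p) module_scheme
    \<Rightarrow> ('k, 'v \<times> 'w \<Rightarrow> 'k) module" where
  "pair_space K V W \<equiv> free_module K (carrier V \<times> carrier W)"

definition tensor_relators ::
  "('k, 'm) ring_scheme \<Rightarrow> ('k, 'v, 'n) module_scheme \<Rightarrow> ('k, 'w, 'p) module_scheme
    \<Rightarrow> ('v \<times> 'w \<Rightarrow> 'k) set" where
  "tensor_relators K V W =
     (let F = pair_space K V W; e = (\<lambda>v w. free_gen K (v, w)) in
       {e (v \<oplus>\<^bsub>V\<^esub> v') w \<ominus>\<^bsub>F\<^esub> (e v w \<oplus>\<^bsub>F\<^esub> e v' w) | v v' w.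
          v \<in> carrier V \<and> v' \<in> carrier V \<and> w \<in> carrier W} \<union>
       {e v (w \<oplus>\<^bsub>W\<^esub> w') \<ominus>\<^bsub>F\<^esub> (e v w \<oplus>\<^bsub>F\<^esub> e v w') | v w w'.
          v \<in> carrier V \<and> w \<in> carrier W \<and> w' \<in> carrier W} \<union>
       {e (c \<odot>\<^bsub>V\<^esub> v) w \<ominus>\<^bsub>F\<^esub> (c \<odot>\<^bsub>F\<^esub> e v w) | c v w.
          c \<in> carrier K \<and> v \<in> carrier V \<and> w \<in> carrier W} \<union>
       {e v (c \<odot>\<^bsub>W\<^esub> w) \<ominus>\<^bsub>F\<^esub> (c \<odot>\<^bsub>F\<^esub> e v w) | c v w.
          c \<in> carrier K \<and> v \<in> carrier V \<and> w \<in> carrier W})"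

definition tensor_kernel ::
  "('k, 'm) ring_scheme \<Rightarrow> ('k, 'v, 'n) module_scheme \<Rightarrow> ('k, 'w, 'p) module_scheme
    \<Rightarrow> ('v \<times> 'w \<Rightarrow> 'k) set" where
  "tensor_kernel K V W = span_of K (pair_space K V W) (tensor_relators K V W)"

definition tensor ::
  "('k, 'm) ring_scheme \<Rightarrow> ('k, 'v, 'n) module_scheme \<Rightarrow> ('k, 'w, 'p) module_scheme
    \<Rightarrow> ('k, ('v \<times> 'w \<Rightarrow> 'k) set) module" where
  "tensor K V W =
     (let F = pair_space K V W; R = tensor_kernel K V W in
      \<lparr>carrier = a_rcosets\<^bsub>F\<^esub> R,
       mult = undefined, one = undefined,
       zero = R, add = (\<lambda>X Y. X <+>\<^bsub>F\<^esub> Y),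
       smult = (\<lambda>c X. \<Union>f\<in>X. R +>\<^bsub>F\<^esub> (c \<odot>\<^bsub>F\<^esub> f))\<rparr>)"

definition pure_tensor ::
  "('k, 'm) ring_scheme \<Rightarrow> ('k, 'v, 'n) module_scheme \<Rightarrow> ('k, 'w, 'p) module_scheme
    \<Rightarrow> 'v \<Rightarrow> 'w \<Rightarrow> ('v \<times> 'w \<Rightarrow> 'k) set" where
  "pure_tensor K V W v w = tensor_kernel K V W +>\<^bsub>pair_space K V W\<^esub> free_gen K (v, w)"

text \<open>
  For bilinear \<open>\<beta> : V \<times> W \<rightarrow> U\<close>, \<open>tensor_lift K U \<beta>\<close> is the induced linear map
  \<open>V \<otimes> W \<rightarrow> U\<close>, computed from an arbitrary representative of the coset. With
  \<open>X = \<Delta>(h)\<close> this is Sweedler notation: \<open>tensor_lift K U \<beta> (\<Delta> h)\<close> is the sum of the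
  \<open>\<beta>(h\<^sub>1, h\<^sub>2)\<close>.
\<close>

definition tensor_lift ::
  "('k, 'm) ring_scheme \<Rightarrow> ('k, 'u, 'n) module_scheme \<Rightarrow> ('v \<Rightarrow> 'w \<Rightarrow> 'u)
    \<Rightarrow> ('v \<times> 'w \<Rightarrow> 'k) set \<Rightarrow> 'u" where
  "tensor_lift K U \<beta> X =
     (let f = (SOME f. f \<in> X) in
      \<Oplus>\<^bsub>U\<^esub>p\<in>{p. f p \<noteq> \<zero>\<^bsub>K\<^esub>}. f p \<odot>\<^bsub>U\<^esub> \<beta> (fst p) (snd p))"


section \<open>Hopf algebras\<close>

text \<open>In an algebra, the \<open>mult\<close> and \<open>one\<close> components of the record are its ring structure.\<close>

locale assoc_algebra =
  fixes K (structure) and A (structure)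
  assumes field: "field K"
    and module: "Module.module K A"
    and ring: "ring A"
    and smult_mult_left:
      "\<lbrakk>c \<in> carrier K; x \<in> carrier A; y \<in> carrier A\<rbrakk>
        \<Longrightarrow> (c \<odot>\<^bsub>A\<^esub> x) \<otimes>\<^bsub>A\<^esub> y = c \<odot>\<^bsub>A\<^esub> (x \<otimes>\<^bsub>A\<^esub> y)"
    and smult_mult_right:
      "\<lbrakk>c \<in> carrier K; x \<in> carrier A; y \<in> carrier A\<rbrakk>
        \<Longrightarrow> x \<otimes>\<^bsub>A\<^esub> (c \<odot>\<^bsub>A\<^esub> y) = c \<odot>\<^bsub>A\<^esub> (x \<otimes>\<^bsub>A\<^esub> y)"

record ('k, 'h) hopf = "('k, 'h) module" +
  comult :: "'h \<Rightarrow> ('h \<times> 'h \<Rightarrow> 'k) set"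
  counit :: "'h \<Rightarrow> 'k"
  antipode :: "'h \<Rightarrow> 'h"

definition tensor_mult ::
  "('k, 'm) ring_scheme \<Rightarrow> ('k, 'h, 'n) module_scheme
    \<Rightarrow> ('h \<times> 'h \<Rightarrow> 'k) set \<Rightarrow> ('h \<times> 'h \<Rightarrow> 'k) set \<Rightarrow> ('h \<times> 'h \<Rightarrow> 'k) set" where
  "tensor_mult K A X Y =
     tensor_lift K (tensor K A A)
       (\<lambda>a b. tensor_lift K (tensor K A A)
          (\<lambda>c d. pure_tensor K A A (a \<otimes>\<^bsub>A\<^esub> c) (b \<otimes>\<^bsub>A\<^esub> d)) Y) X"

text \<open>
  Coassociativity is stated in \<open>H \<otimes> (H \<otimes> H)\<close>: the left-hand side is
  \<open>(\<Delta> \<otimes> id)(\<Delta>(h))\<close> rebracketed.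
\<close>

locale hopf_algebra =
  fixes K :: "('k, 'm) ring_scheme" and H :: "('k, 'h, 'n) hopf_scheme"
  assumes algebra: "assoc_algebra K H"
    and comult_linear: "linear_map K H (tensor K H H) (comult H)"
    and comult_one: "comult H \<one>\<^bsub>H\<^esub> = pure_tensor K H H \<one>\<^bsub>H\<^esub> \<one>\<^bsub>H\<^esub>"
    and comult_mult:
      "\<lbrakk>x \<in> carrier H; y \<in> carrier H\<rbrakk>
        \<Longrightarrow> comult H (x \<otimes>\<^bsub>H\<^esub> y) = tensor_mult K H (comult H x) (comult H y)"
    and counit_closed: "counit H \<in> carrier H \<rightarrow> carrier K"
    and counit_add:
      "\<lbrakk>x \<in> carrier H; y \<in> carrier H\<rbrakk>
        \<Longrightarrow> counit H (x \<oplus>\<^bsub>H\<^esub> y) = counit H x \<oplus>\<^bsub>K\<^esub> counit H y"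
    and counit_smult:
      "\<lbrakk>c \<in> carrier K; x \<in> carrier H\<rbrakk>
        \<Longrightarrow> counit H (c \<odot>\<^bsub>H\<^esub> x) = c \<otimes>\<^bsub>K\<^esub> counit H x"
    and counit_mult:
      "\<lbrakk>x \<in> carrier H; y \<in> carrier H\<rbrakk>
        \<Longrightarrow> counit H (x \<otimes>\<^bsub>H\<^esub> y) = counit H x \<otimes>\<^bsub>K\<^esub> counit H y"
    and counit_one: "counit H \<one>\<^bsub>H\<^esub> = \<one>\<^bsub>K\<^esub>"
    and coassoc:
      "h \<in> carrier H \<Longrightarrow>
        tensor_lift K (tensor K H (tensor K H H))
          (\<lambda>a b. tensor_lift K (tensor K H (tensor K H H))
             (\<lambda>c d. pure_tensor K H (tensor K H H) c (pure_tensor K H H d b)) (comult H a))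
          (comult H h) =
        tensor_lift K (tensor K H (tensor K H H))
          (\<lambda>a b. pure_tensor K H (tensor K H H) a (comult H b)) (comult H h)"
    and counit_left: "h \<in> carrier H \<Longrightarrow>
        tensor_lift K H (\<lambda>a b. counit H a \<odot>\<^bsub>H\<^esub> b) (comult H h) = h"
    and counit_right: "h \<in> carrier H \<Longrightarrow>
        tensor_lift K H (\<lambda>a b. counit H b \<odot>\<^bsub>H\<^esub> a) (comult H h) = h"
    and antipode_linear: "linear_map K H H (antipode H)"
    and antipode_left: "h \<in> carrier H \<Longrightarrow>
        tensor_lift K H (\<lambda>a b. antipode H a \<otimes>\<^bsub>H\<^esub> b) (comult H h) = counit H h \<odot>\<^bsub>H\<^esub> \<one>\<^bsub>H\<^esub>"
    and antipode_right: "h \<in> carrier H \<Longrightarrow>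
        tensor_lift K H (\<lambda>a b. a \<otimes>\<^bsub>H\<^esub> antipode H b) (comult H h) = counit H h \<odot>\<^bsub>H\<^esub> \<one>\<^bsub>H\<^esub>"

text \<open>
  Elements of \<open>D \<otimes> D\<close> and of \<open>H \<otimes> H\<close> are cosets of different subspaces, so a Hopf
  subalgebra carries its own comultiplication, which has to agree with that of \<open>H\<close> under the
  map \<open>D \<otimes> D \<rightarrow> H \<otimes> H\<close> induced by the inclusion.
\<close>

definition hopf_subalgebra ::
  "('k, 'm) ring_scheme \<Rightarrow> ('k, 'h, 'n) hopf_scheme \<Rightarrow> ('k, 'h, 'p) hopf_scheme \<Rightarrow> bool" where
  "hopf_subalgebra K D H \<longleftrightarrow>
     hopf_algebra K D \<and> hopf_algebra K H \<and> carrier D \<subseteq> carrier H \<and>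
     \<one>\<^bsub>D\<^esub> = \<one>\<^bsub>H\<^esub> \<and> \<zero>\<^bsub>D\<^esub> = \<zero>\<^bsub>H\<^esub> \<and>
     (\<forall>x\<in>carrier D. \<forall>y\<in>carrier D. x \<oplus>\<^bsub>D\<^esub> y = x \<oplus>\<^bsub>H\<^esub> y \<and> x \<otimes>\<^bsub>D\<^esub> y = x \<otimes>\<^bsub>H\<^esub> y) \<and>
     (\<forall>c\<in>carrier K. \<forall>x\<in>carrier D. c \<odot>\<^bsub>D\<^esub> x = c \<odot>\<^bsub>H\<^esub> x) \<and>
     (\<forall>x\<in>carrier D. counit D x = counit H x \<and> antipode D x = antipode H x \<and>
        tensor_lift K (tensor K H H) (pure_tensor K H H) (comult D x) = comult H x)"


section \<open>Modules over an algebra\<close>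

record ('k, 'h, 'v) rep = "('k, 'v) module" +
  act :: "'h \<Rightarrow> 'v \<Rightarrow> 'v"

locale alg_module =
  fixes K :: "('k, 'm) ring_scheme" and A :: "('k, 'h, 'n) module_scheme"
    and V :: "('k, 'h, 'v, 'p) rep_scheme"
  assumes vector_space: "Module.module K V"
    and act_closed: "\<lbrakk>a \<in> carrier A; v \<in> carrier V\<rbrakk> \<Longrightarrow> act V a v \<in> carrier V"
    and act_add_left: "\<lbrakk>a \<in> carrier A; b \<in> carrier A; v \<in> carrier V\<rbrakk>
        \<Longrightarrow> act V (a \<oplus>\<^bsub>A\<^esub> b) v = act V a v \<oplus>\<^bsub>V\<^esub> act V b v"
    and act_add_right: "\<lbrakk>a \<in> carrier A; v \<in> carrier V; w \<in> carrier V\<rbrakk>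
        \<Longrightarrow> act V a (v \<oplus>\<^bsub>V\<^esub> w) = act V a v \<oplus>\<^bsub>V\<^esub> act V a w"
    and act_smult_left: "\<lbrakk>c \<in> carrier K; a \<in> carrier A; v \<in> carrier V\<rbrakk>
        \<Longrightarrow> act V (c \<odot>\<^bsub>A\<^esub> a) v = c \<odot>\<^bsub>V\<^esub> act V a v"
    and act_smult_right: "\<lbrakk>c \<in> carrier K; a \<in> carrier A; v \<in> carrier V\<rbrakk>
        \<Longrightarrow> act V a (c \<odot>\<^bsub>V\<^esub> v) = c \<odot>\<^bsub>V\<^esub> act V a v"
    and act_mult: "\<lbrakk>a \<in> carrier A; b \<in> carrier A; v \<in> carrier V\<rbrakk>
        \<Longrightarrow> act V (a \<otimes>\<^bsub>A\<^esub> b) v = act V a (act V b v)"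
    and act_one: "v \<in> carrier V \<Longrightarrow> act V \<one>\<^bsub>A\<^esub> v = v"

text \<open>
  Homomorphisms are extensional functions, so that equal homomorphisms are equal in HOL;
  they are composed with \<open>compose\<close>.
\<close>

definition Hom ::
  "('k, 'm) ring_scheme \<Rightarrow> ('k, 'h, 'n) module_scheme \<Rightarrow> ('k, 'h, 'v) rep \<Rightarrow> ('k, 'h, 'w) rep
    \<Rightarrow> ('v \<Rightarrow> 'w) set" where
  "Hom K A V W =
     {f \<in> carrier V \<rightarrow>\<^sub>E carrier W. linear_map K V W f \<and>
        (\<forall>a\<in>carrier A. \<forall>v\<in>carrier V. f (act V a v) = act W a (f v))}"

definition isomorphic ::
  "('k, 'm) ring_scheme \<Rightarrow> ('k, 'h, 'n) module_scheme \<Rightarrow> ('k, 'h, 'v) rep \<Rightarrow> ('k, 'h, 'w) rep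
    \<Rightarrow> bool" where
  "isomorphic K A V W \<longleftrightarrow> (\<exists>f\<in>Hom K A V W. bij_betw f (carrier V) (carrier W))"

definition res :: "('k, 'h, 'n) module_scheme \<Rightarrow> ('k, 'h, 'v) rep \<Rightarrow> ('k, 'h, 'v) rep" where
  "res D V = V\<lparr>act := restrict (act V) (carrier D)\<rparr>"

definition trivial_rep ::
  "('k, 'm) ring_scheme \<Rightarrow> ('k, 'h, 'n) hopf_scheme \<Rightarrow> ('k, 'h, 'k) rep" where
  "trivial_rep K H =
     \<lparr>carrier = carrier K, mult = mult K, one = \<one>\<^bsub>K\<^esub>, zero = \<zero>\<^bsub>K\<^esub>, add = add K,
      smult = mult K, act = (\<lambda>h x. counit H h \<otimes>\<^bsub>K\<^esub> x)\<rparr>"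

text \<open>The diagonal action \<open>h (v \<otimes> w) = h\<^sub>1 v \<otimes> h\<^sub>2 w\<close> (sum understood).\<close>

definition tensor_rep ::
  "('k, 'm) ring_scheme \<Rightarrow> ('k, 'h, 'n) hopf_scheme \<Rightarrow> ('k, 'h, 'v) rep \<Rightarrow> ('k, 'h, 'w) rep
    \<Rightarrow> ('k, 'h, ('v \<times> 'w \<Rightarrow> 'k) set) rep" where
  "tensor_rep K H V W =
     (let T = tensor K V W in
      \<lparr>carrier = carrier T, mult = undefined, one = undefined, zero = \<zero>\<^bsub>T\<^esub>, add = add T,
       smult = smult T,
       act = (\<lambda>h X. tensor_lift K T
                (\<lambda>a b. tensor_lift K T
                   (\<lambda>v w. pure_tensor K V W (act V a v) (act W b w)) X) (comult H h))\<rparr>)"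

definition subrep ::
  "('k, 'm) ring_scheme \<Rightarrow> ('k, 'h, 'n) module_scheme \<Rightarrow> ('k, 'h, 'v) rep \<Rightarrow> 'v set \<Rightarrow> bool" where
  "subrep K A V W \<longleftrightarrow>
     submodule W K V \<and> (\<forall>a\<in>carrier A. \<forall>w\<in>W. act V a w \<in> W)"

definition locally_finite ::
  "('k, 'm) ring_scheme \<Rightarrow> ('k, 'h, 'n) module_scheme \<Rightarrow> ('k, 'h, 'v) rep \<Rightarrow> bool" where
  "locally_finite K A V \<longleftrightarrow>
     (\<forall>v\<in>carrier V. \<exists>W. subrep K A V W \<and> v \<in> W \<and> fin_dim K (V\<lparr>carrier := W\<rparr>))"


section \<open>Categories of modules\<close>

text \<open>
  A full subcategory of the category of \<open>A\<close>-modules is given by its class of objects, here a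
  set of modules whose underlying sets are subsets of one type \<open>'v\<close>, which is arbitrary and
  plays the role of the universe. Statements such as \<open>V \<otimes> W\<close> being an object mean
  that the set contains a module isomorphic to it.

  The category given by a topology on \<open>H\<close>: the modules \<open>V\<close>, viewed as discrete spaces, on which
  \<open>H\<close> acts continuously. For a linear topology this says that annihilators of
  elements are open.
\<close>

definition continuous_reps ::
  "('k, 'm) ring_scheme \<Rightarrow> ('k, 'h, 'n) module_scheme \<Rightarrow> 'h topology \<Rightarrow> ('k, 'h, 'v) rep set" where
  "continuous_reps K H \<tau> =
     {V. alg_module K H V \<and>
         (\<forall>v\<in>carrier V. continuous_map \<tau> (discrete_topology (carrier V)) (\<lambda>h. act V h v))}"

definition tensor_subcategory ::
  "('k, 'm) ring_scheme \<Rightarrow> ('k, 'h, 'n) hopf_scheme \<Rightarrow> ('k, 'h, 'v) rep set \<Rightarrow> bool" where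
  "tensor_subcategory K H C \<longleftrightarrow>
     (\<forall>V\<in>C. alg_module K H V) \<and>
     (\<exists>T\<in>C. isomorphic K H T (trivial_rep K H)) \<and>
     (\<forall>V\<in>C. \<forall>W\<in>C. \<exists>T\<in>C. isomorphic K H T (tensor_rep K H V W))"

definition is_functor ::
  "('k, 'm) ring_scheme \<Rightarrow> ('k, 'h, 'n) module_scheme \<Rightarrow> ('k, 'h, 'v) rep set
    \<Rightarrow> ('k, 'h, 'p) module_scheme \<Rightarrow> ('k, 'h, 'v) rep set
    \<Rightarrow> (('k, 'h, 'v) rep \<Rightarrow> ('k, 'h, 'v) rep)
    \<Rightarrow> (('k, 'h, 'v) rep \<Rightarrow> ('k, 'h, 'v) rep \<Rightarrow> ('v \<Rightarrow> 'v) \<Rightarrow> ('v \<Rightarrow> 'v)) \<Rightarrow> bool" where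
  "is_functor K A C B C' F F1 \<longleftrightarrow>
     (\<forall>M\<in>C. F M \<in> C') \<and>
     (\<forall>M\<in>C. \<forall>N\<in>C. \<forall>f\<in>Hom K A M N. F1 M N f \<in> Hom K B (F M) (F N)) \<and>
     (\<forall>M\<in>C. F1 M M (\<lambda>x\<in>carrier M. x) = (\<lambda>x\<in>carrier (F M). x)) \<and>
     (\<forall>M\<in>C. \<forall>N\<in>C. \<forall>P\<in>C. \<forall>f\<in>Hom K A M N. \<forall>g\<in>Hom K A N P.
        F1 M P (compose (carrier M) g f) = compose (carrier (F M)) (F1 N P g) (F1 M N f))"

text \<open>
  \<open>(I, I1)\<close> is a functor right adjoint to restriction: there is a bijection
  \<open>\<Phi> V N\<close> from \<open>Hom\<^sub>D(res V, N)\<close> to \<open>Hom\<^sub>H(V, I N)\<close>, natural in \<open>V\<close> and \<open>N\<close>.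
\<close>

definition right_adjoint_res ::
  "('k, 'm) ring_scheme \<Rightarrow> ('k, 'h, 'n) module_scheme \<Rightarrow> ('k, 'h, 'v) rep set
    \<Rightarrow> ('k, 'h, 'p) module_scheme \<Rightarrow> ('k, 'h, 'v) rep set
    \<Rightarrow> (('k, 'h, 'v) rep \<Rightarrow> ('k, 'h, 'v) rep)
    \<Rightarrow> (('k, 'h, 'v) rep \<Rightarrow> ('k, 'h, 'v) rep \<Rightarrow> ('v \<Rightarrow> 'v) \<Rightarrow> ('v \<Rightarrow> 'v)) \<Rightarrow> bool" where
  "right_adjoint_res K D CD H CH I I1 \<longleftrightarrow>
     is_functor K D CD H CH I I1 \<and>
     (\<exists>\<Phi>. (\<forall>V\<in>CH. \<forall>N\<in>CD. bij_betw (\<Phi> V N) (Hom K D (res D V) N) (Hom K H V (I N))) \<and>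
          (\<forall>V\<in>CH. \<forall>V'\<in>CH. \<forall>N\<in>CD. \<forall>N'\<in>CD.
             \<forall>u\<in>Hom K H V' V. \<forall>f\<in>Hom K D (res D V) N. \<forall>g\<in>Hom K D N N'.
               \<Phi> V' N' (compose (carrier V') g (compose (carrier V') f u)) =
               compose (carrier V') (I1 N N' g) (compose (carrier V') (\<Phi> V N f) u)))"

definition tensor_identity ::
  "('k, 'm) ring_scheme \<Rightarrow> ('k, 'h, 'n) hopf_scheme \<Rightarrow> ('k, 'h, 'v) rep set
    \<Rightarrow> ('k, 'h, 'p) hopf_scheme \<Rightarrow> ('k, 'h, 'v) rep set
    \<Rightarrow> (('k, 'h, 'v) rep \<Rightarrow> ('k, 'h, 'v) rep) \<Rightarrow> bool" where
  "tensor_identity K D CD H CH I \<longleftrightarrow>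
     (\<forall>N\<in>CD. \<forall>V\<in>CH.
        (\<exists>M\<in>CD. isomorphic K D M (tensor_rep K D N (res D V))) \<and>
        (\<exists>M\<in>CD. isomorphic K D M (tensor_rep K D (res D V) N)) \<and>
        (\<forall>M\<in>CD. isomorphic K D M (tensor_rep K D N (res D V)) \<longrightarrow>
           isomorphic K H (I M) (tensor_rep K H (I N) V)) \<and>
        (\<forall>M\<in>CD. isomorphic K D M (tensor_rep K D (res D V) N) \<longrightarrow>
           isomorphic K H (I M) (tensor_rep K H V (I N))))"


section \<open>Direct limits\<close>

text \<open>
  Direct systems are indexed by directed preorders; subsets of the universe \<open>'v\<close> serve as
  indices, so that for instance the finite-dimensional submodules of a module form such a system.
  A direct limit in a full subcategory \<open>C\<close> is a universal cocone in \<open>C\<close>.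
\<close>

definition direct_system ::
  "('k, 'm) ring_scheme \<Rightarrow> ('k, 'h, 'n) module_scheme \<Rightarrow> ('k, 'h, 'v) rep set
    \<Rightarrow> 'v set set \<Rightarrow> ('v set \<Rightarrow> 'v set \<Rightarrow> bool) \<Rightarrow> ('v set \<Rightarrow> ('k, 'h, 'v) rep)
    \<Rightarrow> ('v set \<Rightarrow> 'v set \<Rightarrow> 'v \<Rightarrow> 'v) \<Rightarrow> bool" where
  "direct_system K A C J leq X \<phi> \<longleftrightarrow>
     J \<noteq> {} \<and> (\<forall>i\<in>J. leq i i) \<and>
     (\<forall>i\<in>J. \<forall>j\<in>J. \<forall>k\<in>J. leq i j \<longrightarrow> leq j k \<longrightarrow> leq i k) \<and>
     (\<forall>i\<in>J. \<forall>j\<in>J. \<exists>k\<in>J. leq i k \<and> leq j k) \<and>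
     (\<forall>i\<in>J. X i \<in> C) \<and>
     (\<forall>i\<in>J. \<forall>j\<in>J. leq i j \<longrightarrow> \<phi> i j \<in> Hom K A (X i) (X j)) \<and>
     (\<forall>i\<in>J. \<phi> i i = (\<lambda>x\<in>carrier (X i). x)) \<and>
     (\<forall>i\<in>J. \<forall>j\<in>J. \<forall>k\<in>J. leq i j \<longrightarrow> leq j k \<longrightarrow>
        \<phi> i k = compose (carrier (X i)) (\<phi> j k) (\<phi> i j))"

definition cocone ::
  "('k, 'm) ring_scheme \<Rightarrow> ('k, 'h, 'n) module_scheme
    \<Rightarrow> 'v set set \<Rightarrow> ('v set \<Rightarrow> 'v set \<Rightarrow> bool) \<Rightarrow> ('v set \<Rightarrow> ('k, 'h, 'v) rep)
    \<Rightarrow> ('v set \<Rightarrow> 'v set \<Rightarrow> 'v \<Rightarrow> 'v) \<Rightarrow> ('k, 'h, 'v) rep \<Rightarrow> ('v set \<Rightarrow> 'v \<Rightarrow> 'v) \<Rightarrow> bool" where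
  "cocone K A J leq X \<phi> M \<mu> \<longleftrightarrow>
     (\<forall>i\<in>J. \<mu> i \<in> Hom K A (X i) M) \<and>
     (\<forall>i\<in>J. \<forall>j\<in>J. leq i j \<longrightarrow> compose (carrier (X i)) (\<mu> j) (\<phi> i j) = \<mu> i)"

definition direct_limit ::
  "('k, 'm) ring_scheme \<Rightarrow> ('k, 'h, 'n) module_scheme \<Rightarrow> ('k, 'h, 'v) rep set
    \<Rightarrow> 'v set set \<Rightarrow> ('v set \<Rightarrow> 'v set \<Rightarrow> bool) \<Rightarrow> ('v set \<Rightarrow> ('k, 'h, 'v) rep)
    \<Rightarrow> ('v set \<Rightarrow> 'v set \<Rightarrow> 'v \<Rightarrow> 'v) \<Rightarrow> ('k, 'h, 'v) rep \<Rightarrow> ('v set \<Rightarrow> 'v \<Rightarrow> 'v) \<Rightarrow> bool" where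
  "direct_limit K A C J leq X \<phi> L \<iota> \<longleftrightarrow>
     direct_system K A C J leq X \<phi> \<and> L \<in> C \<and> cocone K A J leq X \<phi> L \<iota> \<and>
     (\<forall>M\<in>C. \<forall>\<mu>. cocone K A J leq X \<phi> M \<mu> \<longrightarrow>
        (\<exists>!u. u \<in> Hom K A L M \<and> (\<forall>i\<in>J. compose (carrier (X i)) u (\<iota> i) = \<mu> i)))"

definition commutes_with_direct_limits ::
  "('k, 'm) ring_scheme \<Rightarrow> ('k, 'h, 'n) module_scheme \<Rightarrow> ('k, 'h, 'v) rep set
    \<Rightarrow> ('k, 'h, 'p) module_scheme \<Rightarrow> ('k, 'h, 'v) rep set
    \<Rightarrow> (('k, 'h, 'v) rep \<Rightarrow> ('k, 'h, 'v) rep)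
    \<Rightarrow> (('k, 'h, 'v) rep \<Rightarrow> ('k, 'h, 'v) rep \<Rightarrow> ('v \<Rightarrow> 'v) \<Rightarrow> ('v \<Rightarrow> 'v)) \<Rightarrow> bool" where
  "commutes_with_direct_limits K A C B C' F F1 \<longleftrightarrow>
     (\<forall>J leq X \<phi> L \<iota>. direct_limit K A C J leq X \<phi> L \<iota> \<longrightarrow>
        direct_limit K B C' J leq (\<lambda>i. F (X i)) (\<lambda>i j. F1 (X i) (X j) (\<phi> i j))
          (F L) (\<lambda>i. F1 (X i) L (\<iota> i)))"

definition limits_of_fin_dim ::
  "('k, 'm) ring_scheme \<Rightarrow> ('k, 'h, 'n) module_scheme \<Rightarrow> ('k, 'h, 'v) rep set \<Rightarrow> bool" where
  "limits_of_fin_dim K A C \<longleftrightarrow>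
     (\<forall>V\<in>C. \<exists>J leq X \<phi> \<iota>. direct_limit K A C J leq X \<phi> V \<iota> \<and> (\<forall>i\<in>J. fin_dim K (X i)))"

end

theory Submission
  imports Defs "Jordan_Normal_Form.Missing_VectorSpace"
begin

text \<open>
  The restriction functor from \<open>\<C>(H)\<close> to \<open>\<C>(D)\<close> turns out to be full: every \<open>D\<close>-linear map
  between objects of \<open>\<C>(H)\<close> is already \<open>H\<close>-linear. The theorem follows at once, since an
  isomorphism over either algebra is a bijective linear map over that algebra.

  Fullness is a statement about the unit \<open>\<eta>\<^sub>V : V \<rightarrow> ind (res V)\<close> of the adjunction: if \<open>\<eta>\<^sub>W\<close> is
  bijective, then a \<open>D\<close>-linear map \<open>f : V \<rightarrow> W\<close> equals \<open>\<eta>\<^sub>W\<^sup>-\<^sup>1 \<circ> \<Phi>(f)\<close>, where \<open>\<Phi>(f) : V \<rightarrow> ind (res W)\<close>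
  is the \<open>H\<close>-linear transpose of \<open>f\<close> (lemma \<open>Hom_res_eq\<close>). So the task is to show that \<open>\<eta>\<^sub>V\<close> is
  bijective for every \<open>V\<close>.

  The unit is always injective, because composing it with the counit of the adjunction gives the
  identity (\<open>unit_inj\<close>). By the tensor identity, \<open>ind (res V) \<cong> ind (k \<otimes> res V) \<cong> ind k \<otimes> V \<cong> k \<otimes> V \<cong> V\<close>.
  This isomorphism is not claimed to be \<open>\<eta>\<^sub>V\<close>, but if \<open>V\<close> is finite-dimensional it makes \<open>\<eta>\<^sub>V\<close> an
  injective linear map between spaces of the same finite dimension, hence bijective
  (\<open>unit_bij_fin_dim\<close>). An arbitrary object is a direct limit of finite-dimensional ones.
  Restriction preserves direct limits because it is a left adjoint (\<open>res_direct_limit\<close>), and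
  induction preserves them by assumption; so \<open>\<eta>\<^sub>V\<close> is a direct limit of isomorphisms by naturality
  (\<open>unit_bij_direct_limit\<close>).

  The isomorphism \<open>V \<cong> k \<otimes> V\<close> is used over \<open>D\<close> and over \<open>H\<close>, each time with a module that is only
  isomorphic to the trivial one (\<open>isomorphic_tensor_trivial\<close>). It rests on the universal property
  of the tensor product, proved here for the quotient construction: \<open>tensor_lift\<close> of a bilinear map
  does not depend on the chosen representative (\<open>tensor_lift_coset\<close>).
\<close>

section \<open>Linear maps and subspaces\<close>

text \<open>
  Qualified names below separate \<open>linear_map\<close>, \<open>fin_dim\<close> and \<open>submodule\<close> in the sense of the
  statement from the notions of the same names for the locale \<open>vectorspace\<close>.
\<close>

lemma linear_mapD:
  assumes "Defs.linear_map K V W f"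
  shows "x \<in> carrier V \<Longrightarrow> f x \<in> carrier W"
    and "x \<in> carrier V \<Longrightarrow> y \<in> carrier V \<Longrightarrow> f (x \<oplus>\<^bsub>V\<^esub> y) = f x \<oplus>\<^bsub>W\<^esub> f y"
    and "c \<in> carrier K \<Longrightarrow> x \<in> carrier V \<Longrightarrow> f (c \<odot>\<^bsub>V\<^esub> x) = c \<odot>\<^bsub>W\<^esub> f x"
  using assms unfolding Defs.linear_map_def by auto

lemma linear_map_zero:
  assumes "Module.module K V" "Module.module K W" "Defs.linear_map K V W f"
  shows "f \<zero>\<^bsub>V\<^esub> = \<zero>\<^bsub>W\<^esub>"
proof -
  interpret V: Module.module K V by fact
  interpret W: Module.module K W by fact
  have "f (\<zero>\<^bsub>K\<^esub> \<odot>\<^bsub>V\<^esub> \<zero>\<^bsub>V\<^esub>) = \<zero>\<^bsub>K\<^esub> \<odot>\<^bsub>W\<^esub> f \<zero>\<^bsub>V\<^esub>"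
    by (rule linear_mapD(3)[OF assms(3)]) auto
  then show ?thesis using linear_mapD(1)[OF assms(3), of "\<zero>\<^bsub>V\<^esub>"] by simp
qed

lemma linear_map_minus:
  assumes "Module.module K V" "Module.module K W" "Defs.linear_map K V W f" "x \<in> carrier V"
  shows "f (\<ominus>\<^bsub>V\<^esub> x) = \<ominus>\<^bsub>W\<^esub> f x"
proof -
  interpret V: Module.module K V by fact
  interpret W: Module.module K W by fact
  have "f (\<ominus>\<^bsub>V\<^esub> x) \<oplus>\<^bsub>W\<^esub> f x = \<zero>\<^bsub>W\<^esub>"
    using assms(4) linear_mapD(2)[OF assms(3), of "\<ominus>\<^bsub>V\<^esub> x" x] linear_map_zero[OF assms(1-3)]
    by (simp add: V.M.l_neg)
  then show ?thesis using assms(4) linear_mapD(1)[OF assms(3)]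
    by (metis V.M.a_inv_closed W.M.minus_equality)
qed

lemma linear_map_finsum:
  assumes "Module.module K V" "Module.module K W" "Defs.linear_map K V W f"
    and "finite A" "g \<in> A \<rightarrow> carrier V"
  shows "f (\<Oplus>\<^bsub>V\<^esub>a\<in>A. g a) = (\<Oplus>\<^bsub>W\<^esub>a\<in>A. f (g a))"
proof -
  interpret V: Module.module K V by fact
  interpret W: Module.module K W by fact
  show ?thesis using assms(4,5)
  proof (induction A rule: finite_induct)
    case empty
    then show ?case by (simp add: linear_map_zero[OF assms(1-3)])
  next
    case (insert a A)
    then have "g \<in> A \<rightarrow> carrier V" "g a \<in> carrier V" by auto
    moreover have "(\<lambda>a. f (g a)) \<in> A \<rightarrow> carrier W" "f (g a) \<in> carrier W"
      using calculation linear_mapD(1)[OF assms(3)] by auto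
    ultimately show ?case using insert
      by (simp add: V.M.finsum_insert W.M.finsum_insert linear_mapD(2)[OF assms(3)])
  qed
qed

lemma submodule_kernel:
  assumes V: "Module.module K V" and W: "Module.module K W" and f: "Defs.linear_map K V W f"
  shows "Module.submodule {x \<in> carrier V. f x = \<zero>\<^bsub>W\<^esub>} K V"
proof -
  interpret V: Module.module K V by fact
  interpret W: Module.module K W by fact
  show ?thesis
    by (rule V.submoduleI)
      (auto simp: linear_map_zero[OF assms] linear_map_minus[OF assms] linear_mapD[OF f])
qed

lemma submodule_image:
  assumes V: "Module.module K V" and W: "Module.module K W" and f: "Defs.linear_map K V W f"
  shows "Module.submodule (f ` carrier V) K W"
proof -
  interpret V: Module.module K V by fact
  interpret W: Module.module K W by fact
  show ?thesis
  proof (rule W.submoduleI)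
    show "f ` carrier V \<subseteq> carrier W" using linear_mapD(1)[OF f] by auto
    show "\<zero>\<^bsub>W\<^esub> \<in> f ` carrier V"
      using linear_map_zero[OF assms] by (metis V.M.zero_closed imageI)
  next
    fix a assume "a \<in> f ` carrier V"
    then show "\<ominus>\<^bsub>W\<^esub> a \<in> f ` carrier V"
      using linear_map_minus[OF assms] by (metis (no_types, lifting) V.M.a_inv_closed image_iff)
  next
    fix a b assume "a \<in> f ` carrier V" "b \<in> f ` carrier V"
    then show "a \<oplus>\<^bsub>W\<^esub> b \<in> f ` carrier V"
      using linear_mapD(2)[OF f] by (metis (no_types, lifting) V.M.a_closed image_iff)
  next
    fix c x assume "c \<in> carrier K" "x \<in> f ` carrier V"
    then show "c \<odot>\<^bsub>W\<^esub> x \<in> f ` carrier V"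
      using linear_mapD(3)[OF f] by (metis (no_types, lifting) V.smult_closed image_iff)
  qed
qed

lemma submodule_span_of:
  assumes V: "Module.module K V" and B: "B \<subseteq> carrier V"
  shows "Module.submodule (span_of K V B) K V"
proof -
  interpret V: Module.module K V by fact
  have c: "carrier V \<in> {N. Module.submodule N K V \<and> B \<subseteq> N}"
    using V.carrier_is_submodule B by simp
  note E = V.submoduleE
  show ?thesis
  proof (rule V.submoduleI)
    show "span_of K V B \<subseteq> carrier V" unfolding span_of_def using c by blast
    show "\<zero>\<^bsub>V\<^esub> \<in> span_of K V B"
      unfolding span_of_def
      using subgroup.one_closed[OF Module.submodule.axioms(1)] by fastforce
  next
    fix a assume "a \<in> span_of K V B"
    then show "\<ominus>\<^bsub>V\<^esub> a \<in> span_of K V B" unfolding span_of_def using E(3) by blast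
  next
    fix a b assume "a \<in> span_of K V B" "b \<in> span_of K V B"
    then show "a \<oplus>\<^bsub>V\<^esub> b \<in> span_of K V B" unfolding span_of_def using E(5) by blast
  next
    fix c x assume "c \<in> carrier K" "x \<in> span_of K V B"
    then show "c \<odot>\<^bsub>V\<^esub> x \<in> span_of K V B" unfolding span_of_def using E(4) by blast
  qed
qed

lemma span_of_superset: "B \<subseteq> span_of K V B"
  unfolding span_of_def by blast

lemma span_of_least: "Module.submodule N K V \<Longrightarrow> B \<subseteq> N \<Longrightarrow> span_of K V B \<subseteq> N"
  unfolding span_of_def by blast

text \<open>
  An injective endomorphism of a finite-dimensional space is surjective: it maps a basis to a
  linearly independent set of the same size, which is again a basis.
\<close>

lemma inj_endomorphism_surj:
  assumes K: "field K" and V: "Module.module K V" and fd: "Defs.fin_dim K V"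
    and f: "Defs.linear_map K V V f" and inj: "inj_on f (carrier V)"
  shows "f ` carrier V = carrier V"
proof -
  interpret vectorspace K V using K V by (simp add: vectorspace_def)
  interpret T: VectorSpace.linear_map K V V f
    using f
    by (intro VectorSpace.linear_map.intro mod_hom.intro mod_hom_axioms.intro)
      (auto simp: Defs.linear_map_def module_hom_def vectorspace_axioms V)
  have fin: "fin_dim"
  proof -
    obtain B where B: "finite B" "B \<subseteq> carrier V" "span_of K V B = carrier V"
      using fd unfolding Defs.fin_dim_def by blast
    have s: "LinearCombinations.submodule K (span B) V" by (rule span_is_submodule[OF B(2)])
    have "Module.submodule (span B) K V"
    proof (rule submoduleI)
      show "\<ominus>\<^bsub>V\<^esub> a \<in> span B" if "a \<in> span B" for a using span_neg B(2) that by simp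
    qed (use s in \<open>auto simp: LinearCombinations.submodule_def\<close>)
    then have "carrier V \<subseteq> span B"
      using span_of_least[of "span B" K V B] in_own_span[OF B(2)] B(3) by auto
    then have "span B = carrier V" using span_is_subset2[OF B(2)] by auto
    then show ?thesis using B unfolding fin_dim_def by blast
  qed
  obtain B where B: "finite B" "basis B" using finite_basis_exists[OF fin] by blast
  then have Bc: "B \<subseteq> carrier V" and li: "lin_indpt B" and Bd: "card B = dim"
    using dim_basis unfolding basis_def by auto
  have injB: "inj_on f B" using inj Bc by (rule inj_on_subset)
  have "basis (f ` B)"
  proof (rule dim_li_is_basis[OF fin])
    show fc: "f ` B \<subseteq> carrier V" using Bc by auto
    show "dim \<le> card (f ` B)" using Bd card_image[OF injB] by simp
    show "lin_indpt (f ` B)"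
    proof (rule finite_lin_indpt2[OF _ fc])
      fix a assume a: "a \<in> f ` B \<rightarrow> carrier K" and z: "lincomb a (f ` B) = \<zero>\<^bsub>V\<^esub>"
      have aT: "a \<circ> f \<in> B \<rightarrow> carrier K" using a by auto
      have "f (lincomb (a \<circ> f) B) = f \<zero>\<^bsub>V\<^esub>"
        using T.lincomb_linear_image[OF inj Bc a B(1)] z linear_map_zero[OF V V f] by simp
      then have "lincomb (a \<circ> f) B = \<zero>\<^bsub>V\<^esub>"
        by (rule inj_onD[OF inj]) (use lincomb_closed[OF Bc aT] in auto)
      then have "\<forall>b\<in>B. (a \<circ> f) b = \<zero>\<^bsub>K\<^esub>"
        using li B(1) aT unfolding lin_dep_def by blast
      then show "\<forall>v\<in>f ` B. a v = \<zero>\<^bsub>K\<^esub>" by auto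
    qed (use B in auto)
  qed (use B in auto)
  then have "carrier V = span (f ` B)" unfolding basis_def by simp
  also have "\<dots> \<subseteq> f ` carrier V"
    using span_is_subset[OF _ T.im_is_submodule] Bc unfolding T.im_def by blast
  finally show ?thesis by auto
qed

section \<open>Free modules and linear extension\<close>

lemma free_module_simps [simp]:
  "zero (free_module K B) = (\<lambda>b. \<zero>\<^bsub>K\<^esub>)"
  "add (free_module K B) f g = (\<lambda>b. f b \<oplus>\<^bsub>K\<^esub> g b)"
  "smult (free_module K B) c f = (\<lambda>b. c \<otimes>\<^bsub>K\<^esub> f b)"
  by (simp_all add: free_module_def)

lemma free_module_carrier:
  "f \<in> carrier (free_module K B) \<longleftrightarrow>
    (\<forall>b\<in>B. f b \<in> carrier K) \<and> (\<forall>b. b \<notin> B \<longrightarrow> f b = \<zero>\<^bsub>K\<^esub>) \<and> finite {b. f b \<noteq> \<zero>\<^bsub>K\<^esub>}"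
  by (auto simp: free_module_def)

lemma free_module_closed:
  assumes "cring K" "f \<in> carrier (free_module K B)"
  shows "f b \<in> carrier K"
proof -
  interpret cring K by fact
  show ?thesis using assms(2) by (cases "b \<in> B") (auto simp: free_module_carrier)
qed

lemma module_free_module:
  assumes "cring K"
  shows "Module.module K (free_module K B)"
proof -
  interpret K: cring K by fact
  note c = free_module_closed[OF assms, where B = B]
  have z: "(\<lambda>b. \<zero>\<^bsub>K\<^esub>) \<in> carrier (free_module K B)"
    by (simp add: free_module_carrier)
  have inv: "(\<lambda>b. \<ominus>\<^bsub>K\<^esub> f b) \<in> carrier (free_module K B)" if "f \<in> carrier (free_module K B)" for f
    using that by (auto simp: free_module_carrier elim!: rev_finite_subset)
  show ?thesis
  proof (rule moduleI[OF assms])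
    show "abelian_group (free_module K B)"
    proof (rule abelian_groupI)
      fix f g assume fg: "f \<in> carrier (free_module K B)" "g \<in> carrier (free_module K B)"
      have "finite {b. f b \<oplus>\<^bsub>K\<^esub> g b \<noteq> \<zero>\<^bsub>K\<^esub>}"
        by (rule finite_subset[of _ "{b. f b \<noteq> \<zero>\<^bsub>K\<^esub>} \<union> {b. g b \<noteq> \<zero>\<^bsub>K\<^esub>}"])
          (use fg in \<open>auto simp: free_module_carrier\<close>)
      then show "f \<oplus>\<^bsub>free_module K B\<^esub> g \<in> carrier (free_module K B)"
        using fg by (auto simp: free_module_carrier)
    next
      fix f assume f: "f \<in> carrier (free_module K B)"
      show "\<exists>g\<in>carrier (free_module K B). g \<oplus>\<^bsub>free_module K B\<^esub> f = \<zero>\<^bsub>free_module K B\<^esub>"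
        by (rule bexI[OF _ inv[OF f]]) (use c[OF f] in \<open>auto simp: K.l_neg\<close>)
    qed (use z in \<open>auto simp: c K.a_assoc K.a_comm K.a_lcomm\<close>)
  next
    fix a f assume "a \<in> carrier K" "f \<in> carrier (free_module K B)"
    then show "a \<odot>\<^bsub>free_module K B\<^esub> f \<in> carrier (free_module K B)"
      by (auto simp: free_module_carrier elim!: rev_finite_subset)
  qed (auto simp: c K.l_distr K.r_distr K.m_assoc)
qed

lemma free_gen_closed:
  assumes "field K" "b \<in> B"
  shows "free_gen K b \<in> carrier (free_module K B)"
proof -
  interpret field K by fact
  show ?thesis using assms(2) by (auto simp: free_gen_def free_module_carrier)
qed

text \<open>
  \<open>lin_ext K U \<beta>\<close> is the linear map from a free module to \<open>U\<close> with value \<open>\<beta> b\<close> on the generator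
  \<open>free_gen K b\<close>. The set of generators is not an argument, because the sum runs over the support
  of \<open>f\<close> only.
\<close>

definition lin_ext ::
  "('k, 'm) ring_scheme \<Rightarrow> ('k, 'u, 'n) module_scheme \<Rightarrow> ('b \<Rightarrow> 'u) \<Rightarrow> ('b \<Rightarrow> 'k) \<Rightarrow> 'u" where
  "lin_ext K U \<beta> f = (\<Oplus>\<^bsub>U\<^esub>p\<in>{p. f p \<noteq> \<zero>\<^bsub>K\<^esub>}. f p \<odot>\<^bsub>U\<^esub> \<beta> p)"

text \<open>
  The sum may be taken over any finite set of generators that contains the support. This gives
  two elements a common index set when they are added.
\<close>

lemma lin_ext_eq:
  assumes U: "Module.module K U" and \<beta>: "\<beta> \<in> B \<rightarrow> carrier U"
    and f: "f \<in> carrier (free_module K B)"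
    and S: "finite S" "{p. f p \<noteq> \<zero>\<^bsub>K\<^esub>} \<subseteq> S" "S \<subseteq> B"
  shows "lin_ext K U \<beta> f = (\<Oplus>\<^bsub>U\<^esub>p\<in>S. f p \<odot>\<^bsub>U\<^esub> \<beta> p)"
proof -
  interpret U: Module.module K U by fact
  have c: "f p \<in> carrier K" for p using free_module_closed[OF U.R.cring_axioms f] .
  show ?thesis unfolding lin_ext_def
    by (rule U.M.add.finprod_mono_neutral_cong_left)
      (use S \<beta> c in \<open>auto simp: Pi_def subset_iff\<close>)
qed

lemma lin_ext_linear:
  assumes U: "Module.module K U" and \<beta>: "\<beta> \<in> B \<rightarrow> carrier U"
  shows "Defs.linear_map K (free_module K B) U (lin_ext K U \<beta>)"
proof -
  interpret U: Module.module K U by fact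
  interpret F: Module.module K "free_module K B" by (rule module_free_module[OF U.R.cring_axioms])
  note c = free_module_closed[OF U.R.cring_axioms]
  have supp: "finite {p. f p \<noteq> \<zero>\<^bsub>K\<^esub>}" "{p. f p \<noteq> \<zero>\<^bsub>K\<^esub>} \<subseteq> B"
    if "f \<in> carrier (free_module K B)" for f
    using that by (auto simp: free_module_carrier)
  show ?thesis unfolding Defs.linear_map_def
  proof (intro conjI ballI funcsetI)
    fix f assume f: "f \<in> carrier (free_module K B)"
    show "lin_ext K U \<beta> f \<in> carrier U" unfolding lin_ext_def
      by (rule U.M.finsum_closed) (use supp[OF f] \<beta> c[OF f] in auto)
  next
    fix f g assume f: "f \<in> carrier (free_module K B)" and g: "g \<in> carrier (free_module K B)"
    define S where "S = {p. f p \<noteq> \<zero>\<^bsub>K\<^esub>} \<union> {p. g p \<noteq> \<zero>\<^bsub>K\<^esub>}"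
    have S: "finite S" "S \<subseteq> B" using supp[OF f] supp[OF g] by (auto simp: S_def)
    have \<beta>S: "\<beta> p \<in> carrier U" if "p \<in> S" for p using that S \<beta> by auto
    have "lin_ext K U \<beta> (f \<oplus>\<^bsub>free_module K B\<^esub> g)
        = (\<Oplus>\<^bsub>U\<^esub>p\<in>S. (f \<oplus>\<^bsub>free_module K B\<^esub> g) p \<odot>\<^bsub>U\<^esub> \<beta> p)"
      by (rule lin_ext_eq[OF U \<beta> F.M.a_closed[OF f g] S(1) _ S(2)]) (auto simp: S_def)
    also have "\<dots> = (\<Oplus>\<^bsub>U\<^esub>p\<in>S. f p \<odot>\<^bsub>U\<^esub> \<beta> p \<oplus>\<^bsub>U\<^esub> g p \<odot>\<^bsub>U\<^esub> \<beta> p)"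
      by (rule U.M.finsum_cong') (use \<beta>S c[OF f] c[OF g] in \<open>auto simp: U.smult_l_distr\<close>)
    also have "\<dots> = (\<Oplus>\<^bsub>U\<^esub>p\<in>S. f p \<odot>\<^bsub>U\<^esub> \<beta> p) \<oplus>\<^bsub>U\<^esub> (\<Oplus>\<^bsub>U\<^esub>p\<in>S. g p \<odot>\<^bsub>U\<^esub> \<beta> p)"
      by (rule U.M.finsum_addf) (use \<beta>S c[OF f] c[OF g] in auto)
    also have "(\<Oplus>\<^bsub>U\<^esub>p\<in>S. f p \<odot>\<^bsub>U\<^esub> \<beta> p) = lin_ext K U \<beta> f"
      by (rule lin_ext_eq[OF U \<beta> f S(1) _ S(2), symmetric]) (auto simp: S_def)
    also have "(\<Oplus>\<^bsub>U\<^esub>p\<in>S. g p \<odot>\<^bsub>U\<^esub> \<beta> p) = lin_ext K U \<beta> g"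
      by (rule lin_ext_eq[OF U \<beta> g S(1) _ S(2), symmetric]) (auto simp: S_def)
    finally show "lin_ext K U \<beta> (f \<oplus>\<^bsub>free_module K B\<^esub> g) = lin_ext K U \<beta> f \<oplus>\<^bsub>U\<^esub> lin_ext K U \<beta> g" .
  next
    fix a f assume a: "a \<in> carrier K" and f: "f \<in> carrier (free_module K B)"
    let ?S = "{p. f p \<noteq> \<zero>\<^bsub>K\<^esub>}"
    have \<beta>S: "\<beta> p \<in> carrier U" if "p \<in> ?S" for p using that supp[OF f] \<beta> by auto
    have "lin_ext K U \<beta> (a \<odot>\<^bsub>free_module K B\<^esub> f)
        = (\<Oplus>\<^bsub>U\<^esub>p\<in>?S. (a \<odot>\<^bsub>free_module K B\<^esub> f) p \<odot>\<^bsub>U\<^esub> \<beta> p)"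
      by (rule lin_ext_eq[OF U \<beta> F.smult_closed[OF a f] supp(1)[OF f] _ supp(2)[OF f]])
        (use a in auto)
    also have "\<dots> = (\<Oplus>\<^bsub>U\<^esub>p\<in>?S. a \<odot>\<^bsub>U\<^esub> (f p \<odot>\<^bsub>U\<^esub> \<beta> p))"
      by (rule U.M.finsum_cong') (use \<beta>S c[OF f] a in \<open>auto simp: U.smult_assoc1\<close>)
    also have "\<dots> = a \<odot>\<^bsub>U\<^esub> (\<Oplus>\<^bsub>U\<^esub>p\<in>?S. f p \<odot>\<^bsub>U\<^esub> \<beta> p)"
      by (rule U.finsum_smult_ldistr[symmetric]) (use \<beta>S supp[OF f] c[OF f] a in auto)
    finally show "lin_ext K U \<beta> (a \<odot>\<^bsub>free_module K B\<^esub> f) = a \<odot>\<^bsub>U\<^esub> lin_ext K U \<beta> f"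
      by (simp add: lin_ext_def)
  qed
qed

lemma lin_ext_free_gen:
  assumes K: "field K" and U: "Module.module K U" and \<beta>: "\<beta> \<in> B \<rightarrow> carrier U" and b: "b \<in> B"
  shows "lin_ext K U \<beta> (free_gen K b) = \<beta> b"
proof -
  interpret K: field K by fact
  interpret U: Module.module K U by fact
  have "\<beta> b \<in> carrier U" using \<beta> b by auto
  moreover have "{p. free_gen K b p \<noteq> \<zero>\<^bsub>K\<^esub>} = {b}" by (auto simp: free_gen_def)
  ultimately show ?thesis by (simp add: lin_ext_def free_gen_def U.M.finsum_insert)
qed

text \<open>
  Linear extension commutes with linear maps. The values of \<open>\<gamma>\<close> outside the set of generators do
  not matter; below, \<open>\<gamma>\<close> is itself given by a \<open>tensor_lift\<close> that is only meaningful there.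
\<close>

lemma linear_map_lin_ext:
  assumes U: "Module.module K U" and W: "Module.module K W" and \<phi>: "Defs.linear_map K U W \<phi>"
    and \<beta>: "\<beta> \<in> B \<rightarrow> carrier U" and f: "f \<in> carrier (free_module K B)"
    and \<gamma>: "\<And>b. b \<in> B \<Longrightarrow> \<gamma> b = \<phi> (\<beta> b)"
  shows "\<phi> (lin_ext K U \<beta> f) = lin_ext K W \<gamma> f"
proof -
  interpret U: Module.module K U by fact
  interpret W: Module.module K W by fact
  have c: "f p \<in> carrier K" for p using free_module_closed[OF U.R.cring_axioms f] .
  have supp: "finite {p. f p \<noteq> \<zero>\<^bsub>K\<^esub>}" "{p. f p \<noteq> \<zero>\<^bsub>K\<^esub>} \<subseteq> B"
    using f by (auto simp: free_module_carrier)
  have \<beta>S: "\<beta> p \<in> carrier U" if "f p \<noteq> \<zero>\<^bsub>K\<^esub>" for p using that supp \<beta> by auto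
  have "\<phi> (lin_ext K U \<beta> f) = (\<Oplus>\<^bsub>W\<^esub>p\<in>{p. f p \<noteq> \<zero>\<^bsub>K\<^esub>}. \<phi> (f p \<odot>\<^bsub>U\<^esub> \<beta> p))"
    unfolding lin_ext_def
    by (rule linear_map_finsum[OF U W \<phi> supp(1)]) (use \<beta>S c in auto)
  also have "\<dots> = lin_ext K W \<gamma> f"
    unfolding lin_ext_def
    by (rule W.M.finsum_cong')
      (use \<beta>S c supp \<gamma> linear_mapD[OF \<phi>] in \<open>auto simp: subset_iff\<close>)
  finally show ?thesis .
qed

text \<open>Every element of a free module is the combination of the generators with its own values
  as coefficients.\<close>

lemma lin_ext_free_gen_self:
  assumes K: "field K" and f: "f \<in> carrier (free_module K B)"
  shows "lin_ext K (free_module K B) (free_gen K) f = f"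
proof -
  interpret K: field K by fact
  interpret F: Module.module K "free_module K B" by (rule module_free_module[OF K.cring_axioms])
  have c: "f p \<in> carrier K" for p using free_module_closed[OF K.cring_axioms f] .
  have supp: "finite {p. f p \<noteq> \<zero>\<^bsub>K\<^esub>}" "{p. f p \<noteq> \<zero>\<^bsub>K\<^esub>} \<subseteq> B"
    using f by (auto simp: free_module_carrier)
  have main: "(\<Oplus>\<^bsub>free_module K B\<^esub>p\<in>S. f p \<odot>\<^bsub>free_module K B\<^esub> free_gen K p)
      = (\<lambda>b. if b \<in> S then f b else \<zero>\<^bsub>K\<^esub>)" if "finite S" "S \<subseteq> B" for S
    using that
  proof (induction S rule: finite_induct)
    case empty
    then show ?case by simp
  next
    case (insert s S)
    have g: "f p \<odot>\<^bsub>free_module K B\<^esub> free_gen K p \<in> carrier (free_module K B)" if "p \<in> insert s S" for p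
      by (rule F.smult_closed[OF c free_gen_closed[OF K]]) (use that insert in auto)
    have "(\<Oplus>\<^bsub>free_module K B\<^esub>p\<in>insert s S. f p \<odot>\<^bsub>free_module K B\<^esub> free_gen K p)
      = f s \<odot>\<^bsub>free_module K B\<^esub> free_gen K s \<oplus>\<^bsub>free_module K B\<^esub>
        (\<Oplus>\<^bsub>free_module K B\<^esub>p\<in>S. f p \<odot>\<^bsub>free_module K B\<^esub> free_gen K p)"
      by (rule F.M.finsum_insert) (use insert g in \<open>auto simp del: free_module_simps\<close>)
    also have "\<dots> = (\<lambda>b. if b \<in> insert s S then f b else \<zero>\<^bsub>K\<^esub>)"
      using insert c by (auto simp: free_gen_def fun_eq_iff)
    finally show ?case .
  qed
  show ?thesis unfolding lin_ext_def main[OF supp] using f by (auto simp: fun_eq_iff)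
qed

section \<open>Tensor products\<close>

lemma a_r_coset_eq:
  "abelian_subgroup R F \<Longrightarrow> f \<in> carrier F \<Longrightarrow> g \<in> R +>\<^bsub>F\<^esub> f \<Longrightarrow> R +>\<^bsub>F\<^esub> g = R +>\<^bsub>F\<^esub> f"
  using abelian_subgroup.a_repr_independence' by metis

text \<open>
  Vector spaces \<open>V\<close> and \<open>W\<close> with the data of the quotient construction of \<open>V \<otimes> W\<close>: the free
  vector space \<open>F\<close> on pairs, the span \<open>R\<close> of the bilinearity relations, and the quotient \<open>T\<close>.
\<close>

locale tensor_product =
  fixes K :: "('k, 'm) ring_scheme" and V :: "('k, 'v, 'n) module_scheme"
    and W :: "('k, 'w, 'p) module_scheme"
  assumes field: "field K" and V: "Module.module K V" and W: "Module.module K W"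
begin

abbreviation "F \<equiv> pair_space K V W"
abbreviation "R \<equiv> tensor_kernel K V W"
abbreviation "T \<equiv> tensor K V W"

sublocale K: field K by (rule field)
sublocale V: Module.module K V by (rule V)
sublocale W: Module.module K W by (rule W)
sublocale F: Module.module K F by (rule module_free_module[OF K.cring_axioms])

lemma gen_closed: "v \<in> carrier V \<Longrightarrow> w \<in> carrier W \<Longrightarrow> free_gen K (v, w) \<in> carrier F"
  by (rule free_gen_closed[OF field]) simp

lemma relators_closed: "tensor_relators K V W \<subseteq> carrier F"
  unfolding tensor_relators_def Let_def
  by (auto simp del: free_module_simps intro!: F.M.minus_closed F.M.a_closed F.smult_closed gen_closed)

lemma submodule_tensor_kernel: "Module.submodule R K F"
  unfolding tensor_kernel_def by (rule submodule_span_of[OF F.module_axioms relators_closed])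

sublocale R: abelian_subgroup R F
  by (rule abelian_subgroupI3)
    (use submodule_tensor_kernel F.M.abelian_group_axioms in
      \<open>auto simp: additive_subgroup_def Module.submodule_def\<close>)

lemma carrier_tensor: "carrier T = (\<lambda>f. R +>\<^bsub>F\<^esub> f) ` carrier F"
  by (auto simp: tensor_def Let_def A_RCOSETS_def' )

lemma coset_add:
  assumes "f \<in> carrier F" "g \<in> carrier F"
  shows "(R +>\<^bsub>F\<^esub> f) \<oplus>\<^bsub>T\<^esub> (R +>\<^bsub>F\<^esub> g) = R +>\<^bsub>F\<^esub> (f \<oplus>\<^bsub>F\<^esub> g)"
  using R.a_rcos_sum[OF assms] by (simp add: tensor_def Let_def del: free_module_simps)

text \<open>Scalar multiplication in \<open>T\<close> is a union over representatives; all of them give the same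
  coset.\<close>

lemma coset_smult:
  assumes c: "c \<in> carrier K" and f: "f \<in> carrier F"
  shows "c \<odot>\<^bsub>T\<^esub> (R +>\<^bsub>F\<^esub> f) = R +>\<^bsub>F\<^esub> (c \<odot>\<^bsub>F\<^esub> f)"
proof -
  have "R +>\<^bsub>F\<^esub> (c \<odot>\<^bsub>F\<^esub> g) = R +>\<^bsub>F\<^esub> (c \<odot>\<^bsub>F\<^esub> f)" if g: "g \<in> R +>\<^bsub>F\<^esub> f" for g
  proof -
    obtain r where r: "r \<in> R" "g = r \<oplus>\<^bsub>F\<^esub> f" using g by (auto simp: a_r_coset_def')
    have "c \<odot>\<^bsub>F\<^esub> g = c \<odot>\<^bsub>F\<^esub> r \<oplus>\<^bsub>F\<^esub> c \<odot>\<^bsub>F\<^esub> f"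
      using r R.a_subset c f F.smult_r_distr by blast
    moreover have "c \<odot>\<^bsub>F\<^esub> r \<in> R" using F.submoduleE(4)[OF submodule_tensor_kernel c r(1)] .
    ultimately have "c \<odot>\<^bsub>F\<^esub> g \<in> R +>\<^bsub>F\<^esub> (c \<odot>\<^bsub>F\<^esub> f)" unfolding a_r_coset_def' by blast
    then show ?thesis
      by (rule a_r_coset_eq[OF R.abelian_subgroup_axioms F.smult_closed[OF c f]])
  qed
  moreover have "f \<in> R +>\<^bsub>F\<^esub> f" using R.a_rcos_self[OF f] .
  ultimately have "(\<Union>g\<in>R +>\<^bsub>F\<^esub> f. R +>\<^bsub>F\<^esub> (c \<odot>\<^bsub>F\<^esub> g)) = R +>\<^bsub>F\<^esub> (c \<odot>\<^bsub>F\<^esub> f)"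
    by blast
  then show ?thesis by (simp only: tensor_def Let_def module.simps)
qed

lemma tensor_zero: "\<zero>\<^bsub>T\<^esub> = R +>\<^bsub>F\<^esub> \<zero>\<^bsub>F\<^esub>"
proof -
  have "R +>\<^bsub>F\<^esub> \<zero>\<^bsub>F\<^esub> = R" by (rule F.M.a_coset_add_zero[OF R.a_subset])
  then show ?thesis by (simp add: tensor_def Let_def)
qed

lemma tensor_E:
  assumes "X \<in> carrier T"
  obtains f where "f \<in> carrier F" "X = R +>\<^bsub>F\<^esub> f"
  using assms unfolding carrier_tensor by blast

lemma coset_closed: "f \<in> carrier F \<Longrightarrow> R +>\<^bsub>F\<^esub> f \<in> carrier T"
  unfolding carrier_tensor by blast

lemma module_tensor: "Module.module K T"
proof (rule moduleI[OF K.cring_axioms])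
  show "abelian_group T"
  proof (rule abelian_groupI)
    fix X assume "X \<in> carrier T"
    then obtain f where f: "f \<in> carrier F" "X = R +>\<^bsub>F\<^esub> f" by (rule tensor_E)
    show "\<exists>Y\<in>carrier T. Y \<oplus>\<^bsub>T\<^esub> X = \<zero>\<^bsub>T\<^esub>"
      by (rule bexI[OF _ coset_closed[OF F.M.a_inv_closed[OF f(1)]]])
        (simp only: f(2) coset_add[OF F.M.a_inv_closed[OF f(1)] f(1)] tensor_zero F.M.l_neg[OF f(1)])
    show "\<zero>\<^bsub>T\<^esub> \<oplus>\<^bsub>T\<^esub> X = X"
      by (simp only: f(2) coset_add[OF F.M.zero_closed f(1)] tensor_zero F.M.l_zero[OF f(1)])
  next
    show "\<zero>\<^bsub>T\<^esub> \<in> carrier T"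
      unfolding tensor_zero by (rule coset_closed[OF F.M.zero_closed])
  next
    fix X Y assume X: "X \<in> carrier T" and Y: "Y \<in> carrier T"
    from X obtain f where f: "f \<in> carrier F" "X = R +>\<^bsub>F\<^esub> f" by (rule tensor_E)
    from Y obtain g where g: "g \<in> carrier F" "Y = R +>\<^bsub>F\<^esub> g" by (rule tensor_E)
    show "X \<oplus>\<^bsub>T\<^esub> Y \<in> carrier T"
      unfolding f(2) g(2) coset_add[OF f(1) g(1)]
      by (rule coset_closed[OF F.M.a_closed[OF f(1) g(1)]])
    show "X \<oplus>\<^bsub>T\<^esub> Y = Y \<oplus>\<^bsub>T\<^esub> X"
      by (simp only: f(2) g(2) coset_add[OF f(1) g(1)] coset_add[OF g(1) f(1)]
          F.M.a_comm[OF f(1) g(1)])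
    fix Z assume "Z \<in> carrier T"
    then obtain h where h: "h \<in> carrier F" "Z = R +>\<^bsub>F\<^esub> h" by (rule tensor_E)
    show "X \<oplus>\<^bsub>T\<^esub> Y \<oplus>\<^bsub>T\<^esub> Z = X \<oplus>\<^bsub>T\<^esub> (Y \<oplus>\<^bsub>T\<^esub> Z)"
      by (simp only: f(2) g(2) h(2) coset_add f(1) g(1) h(1) F.M.a_closed
          F.M.a_assoc[OF f(1) g(1) h(1)])
  qed
next
  fix a X assume a: "a \<in> carrier K" and "X \<in> carrier T"
  then obtain f where f: "f \<in> carrier F" "X = R +>\<^bsub>F\<^esub> f" by (elim tensor_E)
  show "a \<odot>\<^bsub>T\<^esub> X \<in> carrier T"
    using a f(1) by (simp add: f(2) coset_smult coset_closed del: free_module_simps)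
next
  fix a b X assume ab: "a \<in> carrier K" "b \<in> carrier K" and "X \<in> carrier T"
  then obtain f where f: "f \<in> carrier F" "X = R +>\<^bsub>F\<^esub> f" by (elim tensor_E)
  show "(a \<oplus>\<^bsub>K\<^esub> b) \<odot>\<^bsub>T\<^esub> X = a \<odot>\<^bsub>T\<^esub> X \<oplus>\<^bsub>T\<^esub> b \<odot>\<^bsub>T\<^esub> X"
    using ab f(1)
    by (simp add: f(2) coset_smult coset_add F.smult_l_distr del: free_module_simps)
  show "(a \<otimes>\<^bsub>K\<^esub> b) \<odot>\<^bsub>T\<^esub> X = a \<odot>\<^bsub>T\<^esub> (b \<odot>\<^bsub>T\<^esub> X)"
    using ab f(1) by (simp add: f(2) coset_smult F.smult_assoc1 del: free_module_simps)
next
  fix a X Y assume a: "a \<in> carrier K" and X: "X \<in> carrier T" and Y: "Y \<in> carrier T"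
  from X obtain f where f: "f \<in> carrier F" "X = R +>\<^bsub>F\<^esub> f" by (rule tensor_E)
  from Y obtain g where g: "g \<in> carrier F" "Y = R +>\<^bsub>F\<^esub> g" by (rule tensor_E)
  show "a \<odot>\<^bsub>T\<^esub> (X \<oplus>\<^bsub>T\<^esub> Y) = a \<odot>\<^bsub>T\<^esub> X \<oplus>\<^bsub>T\<^esub> a \<odot>\<^bsub>T\<^esub> Y"
    using a f(1) g(1)
    by (simp add: f(2) g(2) coset_smult coset_add F.smult_r_distr del: free_module_simps)
next
  fix X assume "X \<in> carrier T"
  then obtain f where f: "f \<in> carrier F" "X = R +>\<^bsub>F\<^esub> f" by (rule tensor_E)
  show "\<one>\<^bsub>K\<^esub> \<odot>\<^bsub>T\<^esub> X = X"
    using f(1) by (simp add: f(2) coset_smult F.smult_one del: free_module_simps)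
qed

sublocale T: Module.module K T by (rule module_tensor)

lemma coset_linear: "Defs.linear_map K F T (\<lambda>f. R +>\<^bsub>F\<^esub> f)"
  unfolding Defs.linear_map_def
  by (intro conjI ballI funcsetI coset_closed coset_add[symmetric] coset_smult[symmetric])

lemma pure_closed: "v \<in> carrier V \<Longrightarrow> w \<in> carrier W \<Longrightarrow> pure_tensor K V W v w \<in> carrier T"
  unfolding pure_tensor_def by (intro coset_closed gen_closed)

lemma coset_eqI:
  assumes "f \<ominus>\<^bsub>F\<^esub> g \<in> R" "f \<in> carrier F" "g \<in> carrier F"
  shows "R +>\<^bsub>F\<^esub> f = R +>\<^bsub>F\<^esub> g"
proof -
  have "f \<in> R +>\<^bsub>F\<^esub> g"
    using R.a_rcos_module[OF assms(3,2)] assms(1) by (simp add: a_minus_def)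
  then show ?thesis by (rule a_r_coset_eq[OF R.abelian_subgroup_axioms assms(3)])
qed

lemma relators_subset: "tensor_relators K V W \<subseteq> R"
  unfolding tensor_kernel_def by (rule span_of_superset)

lemma pure_add_left:
  assumes "v \<in> carrier V" "v' \<in> carrier V" "w \<in> carrier W"
  shows "pure_tensor K V W (v \<oplus>\<^bsub>V\<^esub> v') w = pure_tensor K V W v w \<oplus>\<^bsub>T\<^esub> pure_tensor K V W v' w"
proof -
  have "free_gen K (v \<oplus>\<^bsub>V\<^esub> v', w) \<ominus>\<^bsub>F\<^esub> (free_gen K (v, w) \<oplus>\<^bsub>F\<^esub> free_gen K (v', w)) \<in> R"
    by (rule subsetD[OF relators_subset[unfolded tensor_relators_def Let_def]],
        rule UnI1, rule UnI1, rule UnI1, rule CollectI, intro exI conjI, rule refl) (rule assms)+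
  then show ?thesis unfolding pure_tensor_def
    by (subst coset_add[OF gen_closed gen_closed])
      ((rule assms)+, rule coset_eqI, (assumption | intro gen_closed F.M.a_closed V.M.a_closed W.M.a_closed assms)+)
qed

lemma pure_add_right:
  assumes "v \<in> carrier V" "w \<in> carrier W" "w' \<in> carrier W"
  shows "pure_tensor K V W v (w \<oplus>\<^bsub>W\<^esub> w') = pure_tensor K V W v w \<oplus>\<^bsub>T\<^esub> pure_tensor K V W v w'"
proof -
  have "free_gen K (v, w \<oplus>\<^bsub>W\<^esub> w') \<ominus>\<^bsub>F\<^esub> (free_gen K (v, w) \<oplus>\<^bsub>F\<^esub> free_gen K (v, w')) \<in> R"
    by (rule subsetD[OF relators_subset[unfolded tensor_relators_def Let_def]],
        rule UnI1, rule UnI1, rule UnI2, rule CollectI, intro exI conjI, rule refl) (rule assms)+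
  then show ?thesis unfolding pure_tensor_def
    by (subst coset_add[OF gen_closed gen_closed])
      ((rule assms)+, rule coset_eqI, (assumption | intro gen_closed F.M.a_closed V.M.a_closed W.M.a_closed assms)+)
qed

lemma pure_smult_left:
  assumes "c \<in> carrier K" "v \<in> carrier V" "w \<in> carrier W"
  shows "pure_tensor K V W (c \<odot>\<^bsub>V\<^esub> v) w = c \<odot>\<^bsub>T\<^esub> pure_tensor K V W v w"
proof -
  have "free_gen K (c \<odot>\<^bsub>V\<^esub> v, w) \<ominus>\<^bsub>F\<^esub> (c \<odot>\<^bsub>F\<^esub> free_gen K (v, w)) \<in> R"
    by (rule subsetD[OF relators_subset[unfolded tensor_relators_def Let_def]],
        rule UnI1, rule UnI2, rule CollectI, intro exI conjI, rule refl) (rule assms)+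
  then show ?thesis unfolding pure_tensor_def
    by (subst coset_smult[OF _ gen_closed])
      ((rule assms)+, rule coset_eqI, (assumption | intro gen_closed F.smult_closed V.smult_closed W.smult_closed assms)+)
qed

lemma pure_smult_right:
  assumes "c \<in> carrier K" "v \<in> carrier V" "w \<in> carrier W"
  shows "pure_tensor K V W v (c \<odot>\<^bsub>W\<^esub> w) = c \<odot>\<^bsub>T\<^esub> pure_tensor K V W v w"
proof -
  have "free_gen K (v, c \<odot>\<^bsub>W\<^esub> w) \<ominus>\<^bsub>F\<^esub> (c \<odot>\<^bsub>F\<^esub> free_gen K (v, w)) \<in> R"
    by (rule subsetD[OF relators_subset[unfolded tensor_relators_def Let_def]],
        rule UnI2, rule CollectI, intro exI conjI, rule refl) (rule assms)+
  then show ?thesis unfolding pure_tensor_def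
    by (subst coset_smult[OF _ gen_closed])
      ((rule assms)+, rule coset_eqI, (assumption | intro gen_closed F.smult_closed V.smult_closed W.smult_closed assms)+)
qed

text \<open>Every element of \<open>T\<close> is a linear combination of pure tensors.\<close>

lemma coset_eq_lin_ext:
  assumes f: "f \<in> carrier F"
  shows "R +>\<^bsub>F\<^esub> f = lin_ext K T (\<lambda>p. pure_tensor K V W (fst p) (snd p)) f"
proof -
  have "R +>\<^bsub>F\<^esub> lin_ext K F (free_gen K) f
      = lin_ext K T (\<lambda>p. pure_tensor K V W (fst p) (snd p)) f"
    by (rule linear_map_lin_ext[OF F.module_axioms module_tensor coset_linear _ f])
      (auto intro: gen_closed simp: pure_tensor_def)
  then show ?thesis by (simp only: lin_ext_free_gen_self[OF field f])
qed

text \<open>A subspace of \<open>T\<close> that contains all pure tensors is everything.\<close>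

lemma tensor_induct:
  assumes N: "Module.submodule N K T"
    and pure: "\<And>v w. v \<in> carrier V \<Longrightarrow> w \<in> carrier W \<Longrightarrow> pure_tensor K V W v w \<in> N"
  shows "carrier T \<subseteq> N"
proof
  fix X assume "X \<in> carrier T"
  then obtain f where f: "f \<in> carrier F" "X = R +>\<^bsub>F\<^esub> f" by (rule tensor_E)
  have c: "f p \<in> carrier K" for p using free_module_closed[OF K.cring_axioms f(1)] .
  have NT: "N \<subseteq> carrier T" using T.submoduleE(1)[OF N] .
  have "(\<Oplus>\<^bsub>T\<^esub>p\<in>S. f p \<odot>\<^bsub>T\<^esub> pure_tensor K V W (fst p) (snd p)) \<in> N"
    if "finite S" "S \<subseteq> carrier V \<times> carrier W" for S
    using that
  proof (induction S rule: finite_induct)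
    case empty
    then show ?case
      using subgroup.one_closed[OF Module.submodule.axioms(1)[OF N]] by simp
  next
    case (insert p S)
    have s: "f q \<odot>\<^bsub>T\<^esub> pure_tensor K V W (fst q) (snd q) \<in> N" if "q \<in> insert p S" for q
      using that insert.prems by (intro T.submoduleE(4)[OF N] c pure) auto
    then show ?case
      using insert NT by (subst T.M.finsum_insert) (auto intro!: T.submoduleE(5)[OF N])
  qed
  moreover have "finite {p. f p \<noteq> \<zero>\<^bsub>K\<^esub>}" "{p. f p \<noteq> \<zero>\<^bsub>K\<^esub>} \<subseteq> carrier V \<times> carrier W"
    using f(1) by (auto simp: free_module_carrier)
  ultimately show "X \<in> N"
    unfolding f(2) coset_eq_lin_ext[OF f(1)] lin_ext_def by blast
qed

end

text \<open>
  Bilinear maps \<open>V \<times> W \<rightarrow> U\<close>, in curried form as \<open>tensor_lift\<close> expects them: linear in each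
  argument when the other is fixed in the carrier.
\<close>

definition bilinear_map ::
  "('k, 'm) ring_scheme \<Rightarrow> ('k, 'v, 'n) module_scheme \<Rightarrow> ('k, 'w, 'p) module_scheme
    \<Rightarrow> ('k, 'u, 'q) module_scheme \<Rightarrow> ('v \<Rightarrow> 'w \<Rightarrow> 'u) \<Rightarrow> bool" where
  "bilinear_map K V W U \<beta> \<longleftrightarrow>
     (\<forall>w\<in>carrier W. Defs.linear_map K V U (\<lambda>v. \<beta> v w)) \<and>
     (\<forall>v\<in>carrier V. Defs.linear_map K W U (\<beta> v))"

context tensor_product
begin

lemma pure_bilinear: "bilinear_map K V W T (pure_tensor K V W)"
  unfolding bilinear_map_def Defs.linear_map_def
  by (auto simp: pure_closed pure_add_left pure_add_right pure_smult_left pure_smult_right)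

text \<open>
  The linear extension of a bilinear map kills the relators, so \<open>tensor_lift\<close> does not depend
  on the representative.
\<close>

lemma tensor_lift_coset:
  assumes U: "Module.module K U" and \<beta>: "bilinear_map K V W U \<beta>" and f: "f \<in> carrier F"
  shows "tensor_lift K U \<beta> (R +>\<^bsub>F\<^esub> f) = lin_ext K U (\<lambda>p. \<beta> (fst p) (snd p)) f"
proof -
  interpret U: Module.module K U by fact
  let ?L = "lin_ext K U (\<lambda>p. \<beta> (fst p) (snd p))"
  have l: "Defs.linear_map K V U (\<lambda>v. \<beta> v w)" if "w \<in> carrier W" for w
    using \<beta> that by (simp add: bilinear_map_def)
  have r: "Defs.linear_map K W U (\<beta> v)" if "v \<in> carrier V" for v
    using \<beta> that by (simp add: bilinear_map_def)
  have \<beta>c: "(\<lambda>p. \<beta> (fst p) (snd p)) \<in> carrier V \<times> carrier W \<rightarrow> carrier U"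
    using linear_mapD(1)[OF r] by auto
  have L: "Defs.linear_map K F U ?L" by (rule lin_ext_linear[OF U \<beta>c])
  note Lm = linear_mapD[OF L]
  have Lg: "?L (free_gen K (v, w)) = \<beta> v w" if "v \<in> carrier V" "w \<in> carrier W" for v w
    using lin_ext_free_gen[OF field U \<beta>c, of "(v, w)"] that by simp
  have Ldiff: "?L (g \<ominus>\<^bsub>F\<^esub> h) = \<zero>\<^bsub>U\<^esub>"
    if "g \<in> carrier F" "h \<in> carrier F" "?L g = ?L h" for g h
    using that Lm(1) unfolding a_minus_def
    by (simp add: Lm(2) linear_map_minus[OF F.module_axioms U L] U.M.r_neg del: free_module_simps)
  have "tensor_relators K V W \<subseteq> {g \<in> carrier F. ?L g = \<zero>\<^bsub>U\<^esub>}"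
    unfolding tensor_relators_def Let_def
    by (intro Un_least subsetI CollectI; elim CollectE exE conjE; hypsubst)
      (auto simp del: free_module_simps intro!: F.M.minus_closed F.M.a_closed F.smult_closed
        gen_closed Ldiff simp: Lm(2,3) gen_closed Lg linear_mapD[OF l] linear_mapD[OF r])
  then have ker: "R \<subseteq> {g \<in> carrier F. ?L g = \<zero>\<^bsub>U\<^esub>}"
    unfolding tensor_kernel_def
    by (rule span_of_least[OF submodule_kernel[OF F.module_axioms U L]])
  \<comment> \<open>\<open>g\<close> is the representative that \<open>tensor_lift\<close> chooses; it differs from \<open>f\<close> by an element of
     \<open>R\<close>, which \<open>?L\<close> kills.\<close>
  define g where "g = (SOME g. g \<in> R +>\<^bsub>F\<^esub> f)"
  have "g \<in> R +>\<^bsub>F\<^esub> f"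
    unfolding g_def using someI[of "\<lambda>g. g \<in> R +>\<^bsub>F\<^esub> f", OF R.a_rcos_self[OF f]] .
  then obtain r where r: "r \<in> R" "g = r \<oplus>\<^bsub>F\<^esub> f" by (auto simp: a_r_coset_def')
  then have "?L g = ?L f" using ker f by (auto simp: Lm(1,2) simp del: free_module_simps)
  moreover have "tensor_lift K U \<beta> (R +>\<^bsub>F\<^esub> f) = ?L g"
    by (simp add: tensor_lift_def Let_def g_def lin_ext_def)
  ultimately show ?thesis by simp
qed

lemma tensor_lift_pure:
  assumes U: "Module.module K U" and \<beta>: "bilinear_map K V W U \<beta>"
    and v: "v \<in> carrier V" and w: "w \<in> carrier W"
  shows "tensor_lift K U \<beta> (pure_tensor K V W v w) = \<beta> v w"
  unfolding pure_tensor_def tensor_lift_coset[OF U \<beta> gen_closed[OF v w]]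
  by (subst lin_ext_free_gen[OF field U, where B = "carrier V \<times> carrier W"])
    (use \<beta> v w in \<open>auto simp: bilinear_map_def linear_mapD\<close>)

end

section \<open>Tensoring with a trivial module\<close>

lemma HomD:
  assumes "f \<in> Hom K A V W"
  shows "f \<in> carrier V \<rightarrow>\<^sub>E carrier W" "Defs.linear_map K V W f"
    and "a \<in> carrier A \<Longrightarrow> v \<in> carrier V \<Longrightarrow> f (act V a v) = act W a (f v)"
    and "v \<in> carrier V \<Longrightarrow> f v \<in> carrier W"
  using assms unfolding Hom_def Defs.linear_map_def by auto

text \<open>
  If \<open>E\<close> is isomorphic to the trivial module, then \<open>v \<mapsto> e \<otimes> v\<close> is an isomorphism \<open>V \<cong> E \<otimes> V\<close>, where
  \<open>e\<close> corresponds to \<open>1\<close>. It respects the action because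
  \<open>h\<^sub>1 e \<otimes> h\<^sub>2 v = \<epsilon>(h\<^sub>1) e \<otimes> h\<^sub>2 v = e \<otimes> (\<epsilon>(h\<^sub>1) h\<^sub>2) v\<close> and the counit axiom says \<open>\<epsilon>(h\<^sub>1) h\<^sub>2 = h\<close>.
\<close>

lemma isomorphic_tensor_trivial:
  fixes K :: "('k, 'm) ring_scheme" and A :: "('k, 'h, 'n) hopf_scheme"
    and E :: "('k, 'h, 'v) rep" and V :: "('k, 'h, 'w) rep"
  assumes A: "hopf_algebra K A" and E: "alg_module K A E" and V: "alg_module K A V"
    and triv: "isomorphic K A E (trivial_rep K A)"
  shows "isomorphic K A V (tensor_rep K A E V)"
proof -
  interpret A: hopf_algebra K A by fact
  have K: "field K" and A_mod: "Module.module K A"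
    using A.algebra by (auto simp: assoc_algebra_def)
  interpret K: field K by fact
  interpret E: alg_module K A E by fact
  interpret V: alg_module K A V by fact
  interpret Em: Module.module K E by (rule E.vector_space)
  interpret Vm: Module.module K V by (rule V.vector_space)
  interpret T: tensor_product K E V
    using K E.vector_space V.vector_space by (simp add: tensor_product_def)
  interpret AA: tensor_product K A A
    using K A_mod by (simp add: tensor_product_def)
  let ?T = "tensor K E V"
  obtain t where t: "t \<in> Hom K A E (trivial_rep K A)" "bij_betw t (carrier E) (carrier K)"
    using triv unfolding isomorphic_def by (auto simp: trivial_rep_def)
  have t_closed: "t x \<in> carrier K" if "x \<in> carrier E" for x
    using HomD(4)[OF t(1) that] by (simp add: trivial_rep_def)
  have t_add: "t (x \<oplus>\<^bsub>E\<^esub> y) = t x \<oplus>\<^bsub>K\<^esub> t y" if "x \<in> carrier E" "y \<in> carrier E" for x y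
    using linear_mapD(2)[OF HomD(2)[OF t(1)] that] by (simp add: trivial_rep_def)
  have t_smult: "t (c \<odot>\<^bsub>E\<^esub> x) = c \<otimes>\<^bsub>K\<^esub> t x" if "c \<in> carrier K" "x \<in> carrier E" for c x
    using linear_mapD(3)[OF HomD(2)[OF t(1)] that] by (simp add: trivial_rep_def)
  have t_act: "t (act E a x) = counit A a \<otimes>\<^bsub>K\<^esub> t x" if "a \<in> carrier A" "x \<in> carrier E" for a x
    using HomD(3)[OF t(1) that] by (simp add: trivial_rep_def)
  have t_inj: "x = y" if "t x = t y" "x \<in> carrier E" "y \<in> carrier E" for x y
    using that t(2) by (auto simp: bij_betw_def dest: inj_onD)
  obtain e where e: "e \<in> carrier E" "t e = \<one>\<^bsub>K\<^esub>"
    using t(2) by (metis K.one_closed bij_betw_def imageE)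
  have eps: "counit A a \<in> carrier K" if "a \<in> carrier A" for a
    using A.counit_closed that by auto
  have x_eq: "x = t x \<odot>\<^bsub>E\<^esub> e" if "x \<in> carrier E" for x
    by (rule t_inj) (use that e t_closed[OF that] in \<open>auto simp: t_smult\<close>)
  have act_e: "act E a e = counit A a \<odot>\<^bsub>E\<^esub> e" if "a \<in> carrier A" for a
    by (rule t_inj) (use that e eps[OF that] in \<open>auto simp: t_smult t_act E.act_closed\<close>)

  define g where "g = pure_tensor K E V e"
  have g_lin: "Defs.linear_map K V ?T g"
    using T.pure_bilinear e(1) unfolding g_def bilinear_map_def by blast
  have g_inj: "inj_on g (carrier V)"
  proof (rule inj_on_inverseI)
    \<comment> \<open>The inverse is induced by the bilinear map \<open>(x, v) \<mapsto> t(x) v\<close>.\<close>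
    let ?\<beta> = "\<lambda>x v. t x \<odot>\<^bsub>V\<^esub> v"
    have "bilinear_map K E V V ?\<beta>"
      unfolding bilinear_map_def Defs.linear_map_def
      using t_closed K.m_comm
      by (auto simp: t_add t_smult Vm.smult_l_distr Vm.smult_r_distr Vm.smult_assoc1[symmetric])
    then show "tensor_lift K V ?\<beta> (g v) = v" if "v \<in> carrier V" for v
      using T.tensor_lift_pure[OF V.vector_space _ e(1) that, of ?\<beta>] that e by (simp add: g_def)
  qed
  have g_surj: "g ` carrier V = carrier ?T"
  proof
    show "g ` carrier V \<subseteq> carrier ?T" using linear_mapD(1)[OF g_lin] by auto
    show "carrier ?T \<subseteq> g ` carrier V"
    proof (rule T.tensor_induct[OF submodule_image[OF V.vector_space T.module_tensor g_lin]])
      fix x v assume x: "x \<in> carrier E" and v: "v \<in> carrier V"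
      have "pure_tensor K E V x v = pure_tensor K E V (t x \<odot>\<^bsub>E\<^esub> e) v" using x_eq[OF x] by simp
      also have "\<dots> = g (t x \<odot>\<^bsub>V\<^esub> v)"
        unfolding g_def T.pure_smult_left[OF t_closed[OF x] e(1) v]
          T.pure_smult_right[OF t_closed[OF x] e(1) v] ..
      finally show "pure_tensor K E V x v \<in> g ` carrier V"
        using t_closed[OF x] v by auto
    qed
  qed
  have equivariant: "g (act V h v) = act (tensor_rep K A E V) h (g v)"
    if h: "h \<in> carrier A" and v: "v \<in> carrier V" for h v
  proof -
    let ?\<gamma> = "\<lambda>a b. tensor_lift K ?T (\<lambda>x w. pure_tensor K E V (act E a x) (act V b w)) (g v)"
    have \<gamma>: "?\<gamma> a b = g (act V (counit A a \<odot>\<^bsub>A\<^esub> b) v)" if a: "a \<in> carrier A" and b: "b \<in> carrier A" for a b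
    proof -
      have "bilinear_map K E V ?T (\<lambda>x w. pure_tensor K E V (act E a x) (act V b w))"
        using a b unfolding bilinear_map_def Defs.linear_map_def
        by (auto simp: T.pure_closed E.act_closed V.act_closed E.act_add_right V.act_add_right
            E.act_smult_right V.act_smult_right T.pure_add_left T.pure_add_right
            T.pure_smult_left T.pure_smult_right)
      then have "?\<gamma> a b = pure_tensor K E V (act E a e) (act V b v)"
        unfolding g_def by (rule T.tensor_lift_pure[OF T.module_tensor _ e(1) v])
      also have "\<dots> = g (act V (counit A a \<odot>\<^bsub>A\<^esub> b) v)"
        unfolding g_def act_e[OF a] V.act_smult_left[OF eps[OF a] b v]
          T.pure_smult_left[OF eps[OF a] e(1) V.act_closed[OF b v]]
          T.pure_smult_right[OF eps[OF a] e(1) V.act_closed[OF b v]] ..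
      finally show ?thesis .
    qed
    \<comment> \<open>The action and the counit axiom both evaluate \<open>tensor_lift\<close> at the same chosen
       representative \<open>f\<close> of the comultiplication of \<open>h\<close>, so they can be compared term by term.\<close>
    define f where "f = (SOME f. f \<in> comult A h)"
    have "comult A h \<in> carrier (tensor K A A)"
      by (rule linear_mapD(1)[OF A.comult_linear h])
    then obtain f0 where f0: "f0 \<in> carrier AA.F" "comult A h = tensor_kernel K A A +>\<^bsub>AA.F\<^esub> f0"
      by (rule AA.tensor_E)
    have "f \<in> comult A h"
      unfolding f_def f0(2) using someI[of "\<lambda>g. g \<in> tensor_kernel K A A +>\<^bsub>AA.F\<^esub> f0", OF AA.R.a_rcos_self[OF f0(1)]] .
    then have f: "f \<in> carrier AA.F"
      using AA.F.M.a_r_coset_subset_G[OF AA.R.a_subset f0(1)] f0(2) by blast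
    have \<phi>: "Defs.linear_map K A ?T (\<lambda>a. g (act V a v))"
      using v linear_mapD[OF g_lin] unfolding Defs.linear_map_def
      by (auto simp: V.act_add_left V.act_smult_left V.act_closed)
    have "act (tensor_rep K A E V) h (g v) = lin_ext K ?T (\<lambda>p. ?\<gamma> (fst p) (snd p)) f"
      by (simp add: tensor_rep_def Let_def tensor_lift_def[of K ?T ?\<gamma>] f_def lin_ext_def)
    also have "\<dots> = g (act V (lin_ext K A (\<lambda>p. counit A (fst p) \<odot>\<^bsub>A\<^esub> snd p) f) v)"
      by (rule linear_map_lin_ext[OF A_mod T.module_tensor \<phi> _ f, symmetric])
        (use eps in \<open>auto simp: \<gamma>\<close>)
    also have "lin_ext K A (\<lambda>p. counit A (fst p) \<odot>\<^bsub>A\<^esub> snd p) f = h"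
      using A.counit_left[OF h] by (simp add: tensor_lift_def Let_def lin_ext_def f_def)
    finally show ?thesis by simp
  qed
  have T_simps: "carrier (tensor_rep K A E V) = carrier ?T"
    "add (tensor_rep K A E V) = add ?T" "smult (tensor_rep K A E V) = smult ?T"
    by (simp_all add: tensor_rep_def Let_def)
  show ?thesis unfolding isomorphic_def
  proof (rule bexI)
    show "bij_betw (restrict g (carrier V)) (carrier V) (carrier (tensor_rep K A E V))"
      using g_inj g_surj by (simp add: bij_betw_def T_simps)
    show "restrict g (carrier V) \<in> Hom K A V (tensor_rep K A E V)"
      using linear_mapD[OF g_lin] equivariant
      by (auto simp: Hom_def Defs.linear_map_def T_simps V.act_closed)
  qed
qed

section \<open>The category of modules\<close>

lemma id_Hom:
  assumes "alg_module K A V"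
  shows "(\<lambda>x\<in>carrier V. x) \<in> Hom K A V V"
proof -
  interpret V: alg_module K A V by fact
  interpret Module.module K V by (rule V.vector_space)
  show ?thesis by (auto simp: Hom_def Defs.linear_map_def V.act_closed)
qed

lemma compose_Hom:
  assumes "alg_module K A V" and f: "f \<in> Hom K A V W" and g: "g \<in> Hom K A W X"
  shows "compose (carrier V) g f \<in> Hom K A V X"
proof -
  interpret V: alg_module K A V by fact
  interpret Module.module K V by (rule V.vector_space)
  show ?thesis
    using linear_mapD[OF HomD(2)[OF f]] linear_mapD[OF HomD(2)[OF g]] HomD(3)[OF f] HomD(3)[OF g]
    by (auto simp: Hom_def Defs.linear_map_def V.act_closed compose_def)
qed

lemma compose_id_right:
  "f \<in> Hom K A V W \<Longrightarrow> compose (carrier V) f (\<lambda>x\<in>carrier V. x) = f"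
  using HomD(1)[of f K A V W] by (auto simp: compose_def fun_eq_iff PiE_def extensional_def)

lemma compose_id_left:
  "f \<in> Hom K A V W \<Longrightarrow> compose (carrier V) (\<lambda>x\<in>carrier W. x) f = f"
  using HomD(1)[of f K A V W] by (auto simp: compose_def fun_eq_iff PiE_def extensional_def)

lemma Hom_eqI:
  assumes "f \<in> Hom K A V W" "g \<in> Hom K A V W" "\<And>x. x \<in> carrier V \<Longrightarrow> f x = g x"
  shows "f = g"
  using HomD(1)[OF assms(1)] HomD(1)[OF assms(2)] assms(3) by (rule PiE_ext)

text \<open>
  The codomain need not be known to be a module, since its operations are transported along \<open>f\<close>.
  This matters when it is a tensor product with the diagonal action.
\<close>

lemma inverse_Hom:
  assumes V: "alg_module K A V"
    and f: "f \<in> Hom K A V W" and bij: "bij_betw f (carrier V) (carrier W)"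
  shows "restrict (inv_into (carrier V) f) (carrier W) \<in> Hom K A W V"
proof -
  interpret V: alg_module K A V by fact
  interpret Vm: Module.module K V by (rule V.vector_space)
  let ?g = "inv_into (carrier V) f"
  have c: "?g y \<in> carrier V" if "y \<in> carrier W" for y
    using bij that by (metis bij_betw_def inv_into_into)
  have fg: "f (?g y) = y" if "y \<in> carrier W" for y
    using bij that by (rule bij_betw_inv_into_right)
  have gI: "?g y = x" if "x \<in> carrier V" "f x = y" for x y
    using bij_betw_inv_into_left[OF bij that(1)] that(2) by simp
  note lin = linear_mapD[OF HomD(2)[OF f]]
  have add: "x \<oplus>\<^bsub>W\<^esub> y = f (?g x \<oplus>\<^bsub>V\<^esub> ?g y)" if "x \<in> carrier W" "y \<in> carrier W" for x y
    using lin(2)[of "?g x" "?g y"] c fg that by simp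
  have smult: "r \<odot>\<^bsub>W\<^esub> y = f (r \<odot>\<^bsub>V\<^esub> ?g y)" if "r \<in> carrier K" "y \<in> carrier W" for r y
    using lin(3)[of r "?g y"] c fg that by simp
  have act: "act W a y = f (act V a (?g y))" if "a \<in> carrier A" "y \<in> carrier W" for a y
    using HomD(3)[OF f, of a "?g y"] c fg that by simp
  show ?thesis
    using c lin(1) gI by (auto simp: Hom_def Defs.linear_map_def V.act_closed add smult act)
qed

lemma isomorphic_sym:
  assumes "alg_module K A V" "isomorphic K A V W"
  shows "isomorphic K A W V"
proof -
  obtain f where f: "f \<in> Hom K A V W" "bij_betw f (carrier V) (carrier W)"
    using assms(2) unfolding isomorphic_def by blast
  have "bij_betw (restrict (inv_into (carrier V) f) (carrier W)) (carrier W) (carrier V)"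
    using bij_betw_inv_into[OF f(2)] by (simp cong: bij_betw_cong)
  then show ?thesis
    using inverse_Hom[OF assms(1) f] unfolding isomorphic_def by blast
qed

lemma isomorphic_trans:
  assumes "alg_module K A V" "isomorphic K A V W" "isomorphic K A W X"
  shows "isomorphic K A V X"
proof -
  obtain f g where f: "f \<in> Hom K A V W" "bij_betw f (carrier V) (carrier W)"
    and g: "g \<in> Hom K A W X" "bij_betw g (carrier W) (carrier X)"
    using assms(2,3) unfolding isomorphic_def by blast
  have "bij_betw (compose (carrier V) g f) (carrier V) (carrier X)"
    using bij_betw_trans[OF f(2) g(2)] by (simp add: compose_def comp_def cong: bij_betw_cong)
  then show ?thesis using compose_Hom[OF assms(1) f(1) g(1)] unfolding isomorphic_def by blast
qed

lemma res_simps [simp]: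
  "carrier (res D V) = carrier V" "add (res D V) = add V" "smult (res D V) = smult V"
  "zero (res D V) = zero V"
  by (simp_all add: res_def)

lemma act_res [simp]: "a \<in> carrier D \<Longrightarrow> act (res D V) a = act V a"
  by (simp add: res_def)

lemma Hom_res:
  assumes "carrier D \<subseteq> carrier H" "f \<in> Hom K H V W"
  shows "f \<in> Hom K D (res D V) (res D W)"
  using assms by (auto simp: Hom_def Defs.linear_map_def)

lemma direct_limitD:
  assumes "direct_limit K A C J leq X \<phi> L \<iota>"
  shows "direct_system K A C J leq X \<phi>" and "L \<in> C" and "cocone K A J leq X \<phi> L \<iota>"
    and "i \<in> J \<Longrightarrow> X i \<in> C"
    and "\<lbrakk>i \<in> J; j \<in> J; leq i j\<rbrakk> \<Longrightarrow> \<phi> i j \<in> Hom K A (X i) (X j)"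
    and "i \<in> J \<Longrightarrow> \<iota> i \<in> Hom K A (X i) L"
    and "\<lbrakk>i \<in> J; j \<in> J; leq i j\<rbrakk> \<Longrightarrow> compose (carrier (X i)) (\<iota> j) (\<phi> i j) = \<iota> i"
    and "\<lbrakk>M \<in> C; cocone K A J leq X \<phi> M \<mu>\<rbrakk>
      \<Longrightarrow> \<exists>!u. u \<in> Hom K A L M \<and> (\<forall>i\<in>J. compose (carrier (X i)) u (\<iota> i) = \<mu> i)"
proof -
  show sys: "direct_system K A C J leq X \<phi>" and "L \<in> C" and cc: "cocone K A J leq X \<phi> L \<iota>"
    using assms by (simp_all add: direct_limit_def)
  have "\<forall>i\<in>J. X i \<in> C" using sys unfolding direct_system_def by (elim conjE)
  then show "X i \<in> C" if "i \<in> J" using that by blast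
  have "\<forall>i\<in>J. \<forall>j\<in>J. leq i j \<longrightarrow> \<phi> i j \<in> Hom K A (X i) (X j)"
    using sys unfolding direct_system_def by (elim conjE)
  then show "\<phi> i j \<in> Hom K A (X i) (X j)" if "i \<in> J" "j \<in> J" "leq i j"
    using that by blast
  show "\<iota> i \<in> Hom K A (X i) L" if "i \<in> J" using cc that by (simp add: cocone_def)
  show "compose (carrier (X i)) (\<iota> j) (\<phi> i j) = \<iota> i" if "i \<in> J" "j \<in> J" "leq i j"
    using cc that by (simp add: cocone_def)
  show "\<exists>!u. u \<in> Hom K A L M \<and> (\<forall>i\<in>J. compose (carrier (X i)) u (\<iota> i) = \<mu> i)"
    if "M \<in> C" "cocone K A J leq X \<phi> M \<mu>"
    using assms that unfolding direct_limit_def by (elim conjE) blast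
qed

section \<open>The unit of the adjunction\<close>

text \<open>
  Induction \<open>ind\<close> (with \<open>ind1\<close> on morphisms) is right adjoint to restriction, by means of a fixed
  natural bijection \<open>\<Phi> V N\<close> from \<open>Hom\<^sub>D(res V, N)\<close> to \<open>Hom\<^sub>H(V, ind N)\<close>.
\<close>

locale res_adjunction =
  fixes K :: "('k, 'm) ring_scheme" and D :: "('k, 'h, 'n) module_scheme"
    and H :: "('k, 'h, 'p) module_scheme"
    and CD CH :: "('k, 'h, 'v) rep set"
    and ind :: "('k, 'h, 'v) rep \<Rightarrow> ('k, 'h, 'v) rep"
    and ind1 :: "('k, 'h, 'v) rep \<Rightarrow> ('k, 'h, 'v) rep \<Rightarrow> ('v \<Rightarrow> 'v) \<Rightarrow> ('v \<Rightarrow> 'v)"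
    and \<Phi> :: "('k, 'h, 'v) rep \<Rightarrow> ('k, 'h, 'v) rep \<Rightarrow> ('v \<Rightarrow> 'v) \<Rightarrow> ('v \<Rightarrow> 'v)"
  assumes field: "field K" and sub: "carrier D \<subseteq> carrier H"
    and CH_module: "V \<in> CH \<Longrightarrow> alg_module K H V"
    and CD_module: "N \<in> CD \<Longrightarrow> alg_module K D N"
    and res_closed: "V \<in> CH \<Longrightarrow> res D V \<in> CD"
    and ind_functor: "is_functor K D CD H CH ind ind1"
    and \<Phi>_bij: "\<lbrakk>V \<in> CH; N \<in> CD\<rbrakk>
        \<Longrightarrow> bij_betw (\<Phi> V N) (Hom K D (res D V) N) (Hom K H V (ind N))"
    and \<Phi>_natural: "\<lbrakk>V \<in> CH; V' \<in> CH; N \<in> CD; N' \<in> CD; u \<in> Hom K H V' V;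
          f \<in> Hom K D (res D V) N; g \<in> Hom K D N N'\<rbrakk>
        \<Longrightarrow> \<Phi> V' N' (compose (carrier V') g (compose (carrier V') f u)) =
            compose (carrier V') (ind1 N N' g) (compose (carrier V') (\<Phi> V N f) u)"
begin

lemma ind_closed: "N \<in> CD \<Longrightarrow> ind N \<in> CH"
  using ind_functor unfolding is_functor_def by blast

lemma ind1_Hom: "\<lbrakk>M \<in> CD; N \<in> CD; f \<in> Hom K D M N\<rbrakk> \<Longrightarrow> ind1 M N f \<in> Hom K H (ind M) (ind N)"
  using ind_functor unfolding is_functor_def by blast

lemma ind1_id: "M \<in> CD \<Longrightarrow> ind1 M M (\<lambda>x\<in>carrier M. x) = (\<lambda>x\<in>carrier (ind M). x)"
  using ind_functor unfolding is_functor_def by blast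

lemma \<Phi>_Hom: "\<lbrakk>V \<in> CH; N \<in> CD; f \<in> Hom K D (res D V) N\<rbrakk> \<Longrightarrow> \<Phi> V N f \<in> Hom K H V (ind N)"
  using bij_betwE[OF \<Phi>_bij] by blast

lemma \<Phi>_inj:
  "\<lbrakk>V \<in> CH; N \<in> CD; f \<in> Hom K D (res D V) N; g \<in> Hom K D (res D V) N; \<Phi> V N f = \<Phi> V N g\<rbrakk> \<Longrightarrow> f = g"
  by (rule inj_onD[OF bij_betw_imp_inj_on[OF \<Phi>_bij]])

lemma \<Phi>_surj:
  assumes "V \<in> CH" "N \<in> CD" "g \<in> Hom K H V (ind N)"
  obtains f where "f \<in> Hom K D (res D V) N" "\<Phi> V N f = g"
  using \<Phi>_bij[OF assms(1,2)] assms(3) by (metis bij_betw_def imageE)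

lemma res_Hom: "u \<in> Hom K H V' V \<Longrightarrow> u \<in> Hom K D (res D V') (res D V)"
  by (rule Hom_res[OF sub])

lemma res_compose:
  "\<lbrakk>V' \<in> CH; u \<in> Hom K H V' V; f \<in> Hom K D (res D V) N\<rbrakk>
    \<Longrightarrow> compose (carrier V') f u \<in> Hom K D (res D V') N"
  using compose_Hom[OF CD_module[OF res_closed] res_Hom] by fastforce

lemma \<Phi>_precompose:
  assumes "V \<in> CH" "V' \<in> CH" "N \<in> CD" "u \<in> Hom K H V' V" "f \<in> Hom K D (res D V) N"
  shows "\<Phi> V' N (compose (carrier V') f u) = compose (carrier V') (\<Phi> V N f) u"
proof -
  have "compose (carrier V') f u \<in> Hom K D (res D V') N"
    by (rule res_compose[OF assms(2,4,5)])
  from compose_id_left[OF this]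
  have 1: "compose (carrier V') (\<lambda>x\<in>carrier N. x) (compose (carrier V') f u) = compose (carrier V') f u"
    by simp
  have 2: "compose (carrier V') (\<lambda>x\<in>carrier (ind N). x) (compose (carrier V') (\<Phi> V N f) u)
      = compose (carrier V') (\<Phi> V N f) u"
    by (rule compose_id_left[OF compose_Hom[OF CH_module[OF assms(2)] assms(4) \<Phi>_Hom[OF assms(1,3,5)]]])
  show ?thesis
    using \<Phi>_natural[OF assms(1,2,3,3,4,5) id_Hom[OF CD_module[OF assms(3)]]]
    unfolding 1 ind1_id[OF assms(3)] 2 .
qed

text \<open>The unit \<open>\<eta>\<^sub>V : V \<rightarrow> ind (res V)\<close>: the transpose of the identity of \<open>res V\<close>.\<close>

definition unit :: "('k, 'h, 'v) rep \<Rightarrow> 'v \<Rightarrow> 'v" where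
  "unit V = \<Phi> V (res D V) (\<lambda>x\<in>carrier V. x)"

lemma res_id_Hom: "V \<in> CH \<Longrightarrow> (\<lambda>x\<in>carrier V. x) \<in> Hom K D (res D V) (res D V)"
  by (rule res_Hom[OF id_Hom[OF CH_module]])

lemma unit_Hom: "V \<in> CH \<Longrightarrow> unit V \<in> Hom K H V (ind (res D V))"
  unfolding unit_def by (intro \<Phi>_Hom res_closed res_id_Hom)

text \<open>Over \<open>H\<close>-linear maps, transposition is composition with the unit.\<close>

lemma \<Phi>_res:
  assumes "V \<in> CH" "V' \<in> CH" "u \<in> Hom K H V' V"
  shows "\<Phi> V' (res D V) u = compose (carrier V') (unit V) u"
  using \<Phi>_precompose[OF assms(1,2) res_closed[OF assms(1)] assms(3) res_id_Hom[OF assms(1)]]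
  unfolding unit_def compose_id_left[OF assms(3)] .

lemma \<Phi>_unit:
  assumes V: "V \<in> CH" and N: "N \<in> CD" and f: "f \<in> Hom K D (res D V) N"
  shows "\<Phi> V N f = compose (carrier V) (ind1 (res D V) N f) (unit V)"
proof -
  have i: "(\<lambda>x\<in>carrier V. x) \<in> Hom K H V V" by (rule id_Hom[OF CH_module[OF V]])
  have 1: "compose (carrier V) f (compose (carrier V) (\<lambda>x\<in>carrier V. x) (\<lambda>x\<in>carrier V. x)) = f"
    using compose_id_right[OF f] unfolding compose_id_right[OF i] by simp
  show ?thesis
    using \<Phi>_natural[OF V V res_closed[OF V] N i res_id_Hom[OF V] f]
    unfolding 1 unit_def[symmetric] compose_id_right[OF unit_Hom[OF V]] .
qed

text \<open>Naturality of the unit, obtained by computing the transpose of \<open>u\<close> in two ways.\<close>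

lemma unit_natural:
  assumes V: "V \<in> CH" and V': "V' \<in> CH" and u: "u \<in> Hom K H V' V" and x: "x \<in> carrier V'"
  shows "unit V (u x) = ind1 (res D V') (res D V) u (unit V' x)"
proof -
  have "compose (carrier V') (unit V) u
      = compose (carrier V') (ind1 (res D V') (res D V) u) (unit V')"
    using \<Phi>_res[OF V V' u] \<Phi>_unit[OF V' res_closed[OF V] res_Hom[OF u]] by simp
  from fun_cong[OF this, of x] show ?thesis using x by (simp add: compose_def)
qed

lemma unit_inj:
  assumes V: "V \<in> CH"
  shows "inj_on (unit V) (carrier V)"
proof -
  let ?N = "res D V"
  note N = res_closed[OF V]
  \<comment> \<open>\<open>\<epsilon>\<close> is the counit of the adjunction at \<open>res V\<close>; it is a left inverse of the unit.\<close>
  obtain \<epsilon> where \<epsilon>: "\<epsilon> \<in> Hom K D (res D (ind ?N)) ?N"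
    and \<Phi>\<epsilon>: "\<Phi> (ind ?N) ?N \<epsilon> = (\<lambda>x\<in>carrier (ind ?N). x)"
    using \<Phi>_surj[OF ind_closed[OF N] N id_Hom[OF CH_module[OF ind_closed[OF N]]]] by blast
  have "\<Phi> V ?N (compose (carrier V) \<epsilon> (unit V)) = compose (carrier V) (\<lambda>x\<in>carrier (ind ?N). x) (unit V)"
    using \<Phi>_precompose[OF ind_closed[OF N] V N unit_Hom[OF V] \<epsilon>] unfolding \<Phi>\<epsilon> .
  also have "\<dots> = unit V" by (rule compose_id_left[OF unit_Hom[OF V]])
  finally have "\<Phi> V ?N (compose (carrier V) \<epsilon> (unit V)) = \<Phi> V ?N (\<lambda>x\<in>carrier V. x)"
    by (simp add: unit_def)
  then have eq: "compose (carrier V) \<epsilon> (unit V) = (\<lambda>x\<in>carrier V. x)"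
    by (rule \<Phi>_inj[OF V N res_compose[OF V unit_Hom[OF V] \<epsilon>] res_id_Hom[OF V]])
  show ?thesis
  proof (rule inj_on_inverseI)
    show "\<epsilon> (unit V x) = x" if "x \<in> carrier V" for x
      using fun_cong[OF eq, of x] that by (simp add: compose_def)
  qed
qed

text \<open>
  Any isomorphism \<open>\<psi>\<close> from \<open>ind (res V)\<close> to \<open>V\<close> turns the unit into an injective endomorphism
  of \<open>V\<close>.
\<close>

lemma unit_bij_fin_dim:
  assumes V: "V \<in> CH" and fd: "Defs.fin_dim K V" and iso: "isomorphic K H (ind (res D V)) V"
  shows "bij_betw (unit V) (carrier V) (carrier (ind (res D V)))"
proof -
  obtain \<psi> where \<psi>: "\<psi> \<in> Hom K H (ind (res D V)) V" "bij_betw \<psi> (carrier (ind (res D V))) (carrier V)"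
    using iso unfolding isomorphic_def by blast
  let ?f = "compose (carrier V) \<psi> (unit V)"
  have uc: "unit V x \<in> carrier (ind (res D V))" if "x \<in> carrier V" for x
    by (rule HomD(4)[OF unit_Hom[OF V] that])
  have "?f \<in> Hom K H V V" by (rule compose_Hom[OF CH_module[OF V] unit_Hom[OF V] \<psi>(1)])
  moreover have "inj_on ?f (carrier V)"
    using unit_inj[OF V] \<psi>(2) uc by (auto simp: inj_on_def bij_betw_def compose_def)
  ultimately have surj: "?f ` carrier V = carrier V"
    by (rule inj_endomorphism_surj[OF field alg_module.vector_space[OF CH_module[OF V]] fd HomD(2)])
  have "carrier (ind (res D V)) \<subseteq> unit V ` carrier V"
  proof
    fix y assume y: "y \<in> carrier (ind (res D V))"
    then have "\<psi> y \<in> ?f ` carrier V" unfolding surj by (rule HomD(4)[OF \<psi>(1)])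
    then obtain x where x: "x \<in> carrier V" "\<psi> y = \<psi> (unit V x)" by (auto simp: compose_def)
    then have "y = unit V x" using \<psi>(2) y uc by (auto simp: bij_betw_def dest: inj_onD)
    then show "y \<in> unit V ` carrier V" using x by blast
  qed
  then show ?thesis using unit_inj[OF V] uc by (auto simp: bij_betw_def)
qed

text \<open>
  Restriction, being a left adjoint, preserves direct limits: cocones \<open>\<mu>\<close> from the restricted
  system to \<open>M\<close> correspond to cocones from the original system to \<open>ind M\<close> by transposition.
\<close>

lemma res_direct_limit:
  assumes "direct_limit K H CH J leq X \<phi> L \<iota>"
  shows "direct_limit K D CD J leq (\<lambda>i. res D (X i)) \<phi> (res D L) \<iota>"
proof -
  note lim = direct_limitD[OF assms]
  note sys = lim(1) and L = lim(2) and cc = lim(3) and X = lim(4) and \<phi> = lim(5)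
    and \<iota> = lim(6) and univ = lim(8)
  have "direct_system K D CD J leq (\<lambda>i. res D (X i)) \<phi>"
  proof -
    have "\<forall>i\<in>J. res D (X i) \<in> CD" using X res_closed by blast
    moreover have "\<forall>i\<in>J. \<forall>j\<in>J. leq i j \<longrightarrow> \<phi> i j \<in> Hom K D (res D (X i)) (res D (X j))"
      using \<phi> res_Hom by blast
    ultimately show ?thesis
      using sys unfolding direct_system_def res_simps
      by (elim conjE) (intro conjI; assumption)
  qed
  moreover have "cocone K D J leq (\<lambda>i. res D (X i)) \<phi> (res D L) \<iota>"
    using cc res_Hom unfolding cocone_def res_simps by blast
  moreover have "\<exists>!w. w \<in> Hom K D (res D L) M \<and>
      (\<forall>i\<in>J. compose (carrier (res D (X i))) w (\<iota> i) = \<mu> i)"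
    if M: "M \<in> CD" and \<mu>: "cocone K D J leq (\<lambda>i. res D (X i)) \<phi> M \<mu>" for M \<mu>
  proof -
    have \<mu>H: "\<mu> i \<in> Hom K D (res D (X i)) M" if "i \<in> J" for i
      using \<mu> that unfolding cocone_def by blast
    have \<mu>c: "compose (carrier (X i)) (\<mu> j) (\<phi> i j) = \<mu> i" if "i \<in> J" "j \<in> J" "leq i j" for i j
      using \<mu> that unfolding cocone_def by auto
    have transpose: "(compose (carrier (X i)) w (\<iota> i) = \<mu> i) \<longleftrightarrow>
        (compose (carrier (X i)) (\<Phi> L M w) (\<iota> i) = \<Phi> (X i) M (\<mu> i))"
      if i: "i \<in> J" and w: "w \<in> Hom K D (res D L) M" for i w
      using \<Phi>_precompose[OF L X[OF i] M \<iota>[OF i] w]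
        \<Phi>_inj[OF X[OF i] M res_compose[OF X[OF i] \<iota>[OF i] w] \<mu>H[OF i]] by auto
    have "cocone K H J leq X \<phi> (ind M) (\<lambda>i. \<Phi> (X i) M (\<mu> i))"
      unfolding cocone_def
    proof (intro conjI ballI impI)
      fix i assume "i \<in> J"
      then show "\<Phi> (X i) M (\<mu> i) \<in> Hom K H (X i) (ind M)" by (intro \<Phi>_Hom X M \<mu>H)
    next
      fix i j assume ij: "i \<in> J" "j \<in> J" "leq i j"
      show "compose (carrier (X i)) (\<Phi> (X j) M (\<mu> j)) (\<phi> i j) = \<Phi> (X i) M (\<mu> i)"
        using \<Phi>_precompose[OF X[OF ij(2)] X[OF ij(1)] M \<phi>[OF ij] \<mu>H[OF ij(2)]] \<mu>c[OF ij] by simp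
    qed
    note ex1 = univ[OF ind_closed[OF M] this]
    then obtain u where u: "u \<in> Hom K H L (ind M)"
      "\<forall>i\<in>J. compose (carrier (X i)) u (\<iota> i) = \<Phi> (X i) M (\<mu> i)" by blast
    have uniq: "u' = u" if "u' \<in> Hom K H L (ind M)"
      "\<forall>i\<in>J. compose (carrier (X i)) u' (\<iota> i) = \<Phi> (X i) M (\<mu> i)" for u'
      using ex1 u that by blast
    obtain w where w: "w \<in> Hom K D (res D L) M" "\<Phi> L M w = u" by (rule \<Phi>_surj[OF L M u(1)])
    show ?thesis
    proof (rule ex1I[of _ w])
      show "w \<in> Hom K D (res D L) M \<and> (\<forall>i\<in>J. compose (carrier (res D (X i))) w (\<iota> i) = \<mu> i)"
        using w u(2) transpose by simp
    next
      fix w' assume w': "w' \<in> Hom K D (res D L) M \<and>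
        (\<forall>i\<in>J. compose (carrier (res D (X i))) w' (\<iota> i) = \<mu> i)"
      then have "\<Phi> L M w' = u"
        using transpose by (intro uniq \<Phi>_Hom L M) auto
      then show "w' = w" using \<Phi>_inj[OF L M _ w(1)] w(2) w' by simp
    qed
  qed
  ultimately show ?thesis unfolding direct_limit_def using res_closed[OF L] by blast
qed

text \<open>
  If the unit is bijective on every term of a direct system, it is bijective on the limit. The
  inverse \<open>u\<close> is induced by the cocone \<open>\<mu>\<^sub>i = \<iota>\<^sub>i \<circ> \<eta>\<^sub>i\<^sup>-\<^sup>1\<close> from the induced system.
\<close>

lemma unit_bij_direct_limit:
  assumes lim: "direct_limit K H CH J leq X \<phi> V \<iota>"
    and comm: "commutes_with_direct_limits K D CD H CH ind ind1"
    and bij: "\<And>i. i \<in> J \<Longrightarrow> bij_betw (unit (X i)) (carrier (X i)) (carrier (ind (res D (X i))))"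
  shows "bij_betw (unit V) (carrier V) (carrier (ind (res D V)))"
proof -
  let ?X = "\<lambda>i. ind (res D (X i))" and ?V = "ind (res D V)"
  let ?\<phi> = "\<lambda>i j. ind1 (res D (X i)) (res D (X j)) (\<phi> i j)"
  let ?\<iota> = "\<lambda>i. ind1 (res D (X i)) (res D V) (\<iota> i)"
  have lim': "direct_limit K H CH J leq ?X ?\<phi> ?V ?\<iota>"
    using comm res_direct_limit[OF lim] unfolding commutes_with_direct_limits_def by blast
  note V = direct_limitD(2)[OF lim] and V' = direct_limitD(2)[OF lim']
  note X = direct_limitD(4)[OF lim] and X' = direct_limitD(4)[OF lim']
  note \<phi> = direct_limitD(5)[OF lim] direct_limitD(5)[OF lim']
  note cc = direct_limitD(3)[OF lim] direct_limitD(3)[OF lim']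
  note \<iota> = direct_limitD(6)[OF lim] direct_limitD(6)[OF lim']
  note univ = direct_limitD(8)[OF lim] and univ' = direct_limitD(8)[OF lim']
  have \<iota>\<phi>: "\<iota> j (\<phi> i j x) = \<iota> i x" if "i \<in> J" "j \<in> J" "leq i j" "x \<in> carrier (X i)" for i j x
    using fun_cong[OF direct_limitD(7)[OF lim that(1-3)], of x] that(4) by (simp add: compose_def)

  define \<theta> where "\<theta> i = restrict (inv_into (carrier (X i)) (unit (X i))) (carrier (?X i))" for i
  have \<theta>: "\<theta> i \<in> Hom K H (?X i) (X i)" if "i \<in> J" for i
    unfolding \<theta>_def
    by (rule inverse_Hom[OF CH_module[OF X[OF that]] unit_Hom[OF X[OF that]]
          bij[OF that]])
  have \<theta>_unit: "\<theta> i (unit (X i) x) = x" if "i \<in> J" "x \<in> carrier (X i)" for i x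
    using bij_betw_inv_into_left[OF bij[OF that(1)] that(2)] HomD(4)[OF unit_Hom[OF X[OF that(1)]] that(2)]
    by (simp add: \<theta>_def)
  have surj: "\<exists>x\<in>carrier (X i). y = unit (X i) x" if "i \<in> J" "y \<in> carrier (?X i)" for i y
    using bij[OF that(1)] that(2) unfolding bij_betw_def by blast
  define \<mu> where "\<mu> i = compose (carrier (?X i)) (\<iota> i) (\<theta> i)" for i
  have \<mu>_unit: "\<mu> i (unit (X i) x) = \<iota> i x" if "i \<in> J" "x \<in> carrier (X i)" for i x
    using HomD(4)[OF unit_Hom[OF X[OF that(1)]] that(2)] \<theta>_unit[OF that]
    by (simp add: \<mu>_def compose_def)
  have \<mu>: "\<mu> i \<in> Hom K H (?X i) V" if "i \<in> J" for i
    unfolding \<mu>_def by (rule compose_Hom[OF CH_module[OF X'[OF that]] \<theta>[OF that] \<iota>(1)[OF that]])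
  have "cocone K H J leq ?X ?\<phi> V \<mu>"
    unfolding cocone_def
  proof (intro conjI ballI impI)
    fix i j assume ij: "i \<in> J" "j \<in> J" "leq i j"
    show "compose (carrier (?X i)) (\<mu> j) (?\<phi> i j) = \<mu> i"
    proof (rule Hom_eqI[OF compose_Hom[OF CH_module[OF X'[OF ij(1)]] \<phi>(2)[OF ij] \<mu>[OF ij(2)]] \<mu>[OF ij(1)]])
      fix y assume y: "y \<in> carrier (?X i)"
      then obtain x where x: "x \<in> carrier (X i)" "y = unit (X i) x" using surj[OF ij(1)] by blast
      have "\<mu> j (?\<phi> i j y) = \<mu> j (unit (X j) (\<phi> i j x))"
        unfolding x(2) unit_natural[OF X[OF ij(2)] X[OF ij(1)] \<phi>(1)[OF ij] x(1)] ..
      also have "\<dots> = \<iota> i x"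
        using \<mu>_unit[OF ij(2) HomD(4)[OF \<phi>(1)[OF ij] x(1)]] \<iota>\<phi>[OF ij x(1)] by simp
      also have "\<dots> = \<mu> i y" unfolding x(2) \<mu>_unit[OF ij(1) x(1)] ..
      finally show "compose (carrier (?X i)) (\<mu> j) (?\<phi> i j) y = \<mu> i y"
        using y by (simp add: compose_def)
    qed
  qed (rule \<mu>)
  from univ'[OF V this] obtain u where u: "u \<in> Hom K H ?V V"
    and u\<iota>: "\<And>i. i \<in> J \<Longrightarrow> compose (carrier (?X i)) u (?\<iota> i) = \<mu> i" by blast
  have u_app: "u (?\<iota> i y) = \<mu> i y" if "i \<in> J" "y \<in> carrier (?X i)" for i y
    using fun_cong[OF u\<iota>[OF that(1)], of y] that(2) by (simp add: compose_def)
  have u_unit: "u (unit V (\<iota> i x)) = \<iota> i x" if "i \<in> J" "x \<in> carrier (X i)" for i x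
    using unit_natural[OF V X[OF that(1)] \<iota>(1)[OF that(1)] that(2)]
      u_app[OF that(1) HomD(4)[OF unit_Hom[OF X[OF that(1)]] that(2)]] \<mu>_unit[OF that] by simp
  have "compose (carrier V) u (unit V) = (\<lambda>x\<in>carrier V. x)"
  proof -
    have c: "compose (carrier V) u (unit V) \<in> Hom K H V V"
      by (rule compose_Hom[OF CH_module[OF V] unit_Hom[OF V] u])
    have "compose (carrier (X i)) (compose (carrier V) u (unit V)) (\<iota> i) = \<iota> i" if i: "i \<in> J" for i
      by (rule Hom_eqI[OF compose_Hom[OF CH_module[OF X[OF i]] \<iota>(1)[OF i] c] \<iota>(1)[OF i]])
        (use u_unit[OF i] HomD(4)[OF \<iota>(1)[OF i]] in \<open>simp add: compose_def\<close>)
    moreover have "compose (carrier (X i)) (\<lambda>x\<in>carrier V. x) (\<iota> i) = \<iota> i" if i: "i \<in> J" for i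
      by (rule compose_id_left[OF \<iota>(1)[OF i]])
    ultimately show ?thesis using univ[OF V cc(1)] c id_Hom[OF CH_module[OF V]] by blast
  qed
  then have left: "u (unit V x) = x" if "x \<in> carrier V" for x
    using that by (metis compose_eq restrict_apply')
  have "compose (carrier ?V) (unit V) u = (\<lambda>x\<in>carrier ?V. x)"
  proof -
    have c: "compose (carrier ?V) (unit V) u \<in> Hom K H ?V ?V"
      by (rule compose_Hom[OF CH_module[OF V'] u unit_Hom[OF V]])
    have "compose (carrier (?X i)) (compose (carrier ?V) (unit V) u) (?\<iota> i) = ?\<iota> i" if i: "i \<in> J" for i
    proof (rule Hom_eqI[OF compose_Hom[OF CH_module[OF X'[OF i]] \<iota>(2)[OF i] c] \<iota>(2)[OF i]])
      fix y assume y: "y \<in> carrier (?X i)"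
      then obtain x where x: "x \<in> carrier (X i)" "y = unit (X i) x" using surj[OF i] by blast
      have "unit V (u (?\<iota> i y)) = unit V (\<iota> i x)"
        using u_app[OF i y] \<mu>_unit[OF i x(1)] x(2) by simp
      also have "\<dots> = ?\<iota> i y"
        using unit_natural[OF V X[OF i] \<iota>(1)[OF i] x(1)] x(2) by simp
      finally show "compose (carrier (?X i)) (compose (carrier ?V) (unit V) u) (?\<iota> i) y = ?\<iota> i y"
        using y HomD(4)[OF \<iota>(2)[OF i] y] by (simp add: compose_def)
    qed
    moreover have "compose (carrier (?X i)) (\<lambda>x\<in>carrier ?V. x) (?\<iota> i) = ?\<iota> i" if i: "i \<in> J" for i
      by (rule compose_id_left[OF \<iota>(2)[OF i]])
    ultimately show ?thesis using univ'[OF V' cc(2)] c id_Hom[OF CH_module[OF V']] by blast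
  qed
  then have right: "unit V (u y) = y" if "y \<in> carrier ?V" for y
    using that by (metis compose_eq restrict_apply')
  show ?thesis
    by (rule bij_betw_byWitness[where f' = u])
      (use left right HomD(4)[OF u] HomD(4)[OF unit_Hom[OF V]] in auto)
qed

text \<open>Full faithfulness of restriction on morphisms into an object with bijective unit.\<close>

lemma Hom_res_eq:
  assumes V: "V \<in> CH" and W: "W \<in> CH"
    and bij: "bij_betw (unit W) (carrier W) (carrier (ind (res D W)))"
  shows "Hom K D (res D V) (res D W) = Hom K H V W"
proof
  show "Hom K H V W \<subseteq> Hom K D (res D V) (res D W)" using res_Hom by blast
  show "Hom K D (res D V) (res D W) \<subseteq> Hom K H V W"
  proof
    fix f assume f: "f \<in> Hom K D (res D V) (res D W)"
    let ?N = "res D W"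
    note N = res_closed[OF W]
    let ?\<theta> = "restrict (inv_into (carrier W) (unit W)) (carrier (ind ?N))"
    define g where "g = compose (carrier V) ?\<theta> (\<Phi> V ?N f)"
    note \<Phi>f = \<Phi>_Hom[OF V N f]
    have g: "g \<in> Hom K H V W"
      unfolding g_def
      by (rule compose_Hom[OF CH_module[OF V] \<Phi>f
            inverse_Hom[OF CH_module[OF W] unit_Hom[OF W] bij]])
    have "\<Phi> V ?N g = compose (carrier V) (unit W) g" by (rule \<Phi>_res[OF W V g])
    also have "\<dots> = \<Phi> V ?N f"
      by (rule Hom_eqI[OF compose_Hom[OF CH_module[OF V] g unit_Hom[OF W]] \<Phi>f])
        (use HomD(4)[OF \<Phi>f] bij_betw_inv_into_right[OF bij] in \<open>simp add: g_def compose_def\<close>)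
    finally have "g = f" using \<Phi>_inj[OF V N res_Hom[OF g] f] by simp
    then show "f \<in> Hom K H V W" using g by simp
  qed
qed

end

section \<open>Restriction reflects isomorphism\<close>

theorem proposition8p4p2:
  fixes K :: "'k ring"
    and H D :: "('k, 'h) hopf"
    and \<tau> :: "'h topology"
    and CH CD :: "('k, 'h, 'v) rep set"
    and ind :: "('k, 'h, 'v) rep \<Rightarrow> ('k, 'h, 'v) rep"
    and ind1 :: "('k, 'h, 'v) rep \<Rightarrow> ('k, 'h, 'v) rep \<Rightarrow> ('v \<Rightarrow> 'v) \<Rightarrow> ('v \<Rightarrow> 'v)"
    and k :: "('k, 'h, 'v) rep"
  assumes field: "field K"
    and hopf: "hopf_algebra K H"
    and bij_antipode: "bij_betw (antipode H) (carrier H) (carrier H)"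
    and topology: "topspace \<tau> = carrier H"
    and CH: "CH = continuous_reps K H \<tau>"
    and tensor_CH: "tensor_subcategory K H CH"
    and sub: "hopf_subalgebra K D H"
    and CD: "\<forall>N\<in>CD. alg_module K D N"
    and res: "\<forall>V\<in>CH. res D V \<in> CD"
    and ind: "right_adjoint_res K D CD H CH ind ind1"
    and ind_limits: "commutes_with_direct_limits K D CD H CH ind ind1"
    and CH_limits: "limits_of_fin_dim K H CH"
    and tensor_id: "tensor_identity K D CD H CH ind"
    and loc_fin: "\<forall>V\<in>CH. locally_finite K H V"
    and k: "k \<in> CD" "isomorphic K D k (trivial_rep K D)"
    and ind_k: "isomorphic K H (ind k) (trivial_rep K H)"
    and V: "V1 \<in> CH" "V2 \<in> CH"
  shows "isomorphic K H V1 V2 \<longleftrightarrow> isomorphic K D (res D V1) (res D V2)"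
proof -
  have D: "hopf_algebra K D" and DH: "carrier D \<subseteq> carrier H"
    using sub unfolding hopf_subalgebra_def by blast+
  have CH_mod: "\<forall>V\<in>CH. alg_module K H V"
    using tensor_CH unfolding tensor_subcategory_def by (rule conjunct1)
  obtain \<Phi> where
    \<Phi>: "\<forall>V\<in>CH. \<forall>N\<in>CD. bij_betw (\<Phi> V N) (Hom K D (res D V) N) (Hom K H V (ind N))"
      "\<forall>V\<in>CH. \<forall>V'\<in>CH. \<forall>N\<in>CD. \<forall>N'\<in>CD.
         \<forall>u\<in>Hom K H V' V. \<forall>f\<in>Hom K D (res D V) N. \<forall>g\<in>Hom K D N N'.
           \<Phi> V' N' (compose (carrier V') g (compose (carrier V') f u)) =
           compose (carrier V') (ind1 N N' g) (compose (carrier V') (\<Phi> V N f) u)"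
    and ind_functor: "is_functor K D CD H CH ind ind1"
    using ind unfolding right_adjoint_res_def by (elim conjE exE)
  have "res_adjunction K D H CD CH ind ind1 \<Phi>"
    by (intro res_adjunction.intro field DH ind_functor CH_mod[rule_format] CD[rule_format]
        res[rule_format] \<Phi>(1)[rule_format] \<Phi>(2)[rule_format])
  then interpret adj: res_adjunction K D H CD CH ind ind1 \<Phi> .
  have iso: "isomorphic K H (ind (res D V)) V" if V: "V \<in> CH" for V
  proof -
    note N = adj.res_closed[OF V]
    have "isomorphic K D (res D V) (tensor_rep K D k (res D V))"
      by (rule isomorphic_tensor_trivial[OF D adj.CD_module[OF k(1)] adj.CD_module[OF N] k(2)])
    then have 1: "isomorphic K H (ind (res D V)) (tensor_rep K H (ind k) V)"
      using tensor_id k(1) V N unfolding tensor_identity_def by blast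
    note 2 = isomorphic_tensor_trivial[OF hopf adj.CH_module[OF adj.ind_closed[OF k(1)]]
        adj.CH_module[OF V] ind_k]
    show ?thesis
      by (rule isomorphic_trans[OF adj.CH_module[OF adj.ind_closed[OF N]] 1
            isomorphic_sym[OF adj.CH_module[OF V] 2]])
  qed
  have "bij_betw (adj.unit V2) (carrier V2) (carrier (ind (res D V2)))"
  proof -
    obtain J leq X \<phi> \<iota> where lim: "direct_limit K H CH J leq X \<phi> V2 \<iota>"
      and fd: "\<And>i. i \<in> J \<Longrightarrow> Defs.fin_dim K (X i)"
      using CH_limits V(2) unfolding limits_of_fin_dim_def by blast
    have "X i \<in> CH" if "i \<in> J" for i
      using direct_limitD(4)[OF lim that] .
    then show ?thesis
      by (intro adj.unit_bij_direct_limit[OF lim ind_limits] adj.unit_bij_fin_dim iso fd)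
  qed
  from adj.Hom_res_eq[OF V this] show ?thesis unfolding isomorphic_def by simp
qed

end
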